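(* Let $V$ be a member of the family $V^a$. The set of divisors in the anticanonical linear system $|-K_V|\cong\mathbb{P}^{13}$ which are fixed by the $\mathbb{C}^{*}$-action (i.e. the set of $\mathbb{C}^*$-invariant divisors, viewed as a subset of $|-K_V|$) consists of $12$ points and a line.
   Context: A Mukai threefold is a smooth Fano threefold $X$ over $\mathbb{C}$ with Picard group generated by $-K_X$ and of genus $12$, i.e. $\frac12(-K_X)^3+1=12$. The family $V^a$ consists of the Mukai threefolds whose automorphism group has identity component isomorphic to $\mathbb{C}^{*}$; the $\mathbb{C}^*$-action on a member $V$ is that of this identity component. Explicitly, members of $V^a$ are described as follows. Let $W_7$ be a complex vector space with basis $e_{-3},\dots,e_3$, let $\tau\in\mathbb{C}$, and let $L_\tau\subset\bigwedge^2W_7$ be spanned by $$\omega_1=e_0\wedge e_1+e_{-1}\wedge e_2+e_{-2}\wedge e_3,\quad \omega_0=e_{-1}\wedge e_1+e_{-2}\wedge e_2+\tau e_{-3}\wedge e_3,\quad \omega_{-1}=e_{-1}\wedge e_0+e_{-2}\wedge e_1+e_{-3}\wedge e_2.$$ Then $V=\{[\alpha]\in G(4,W_7)\subset\mathbb{P}(\bigwedge^4W_7): \alpha\wedge\omega=0\ \forall\omega\in L_\tau\}\subset\mathbb{P}^{13}$, embedded by $|-K_V|$, with $\mathbb{C}^*$-action induced by $e_j\mapsto s^je_j$, $s\in\mathbb{C}^*$. *)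

theory Defs
  imports "HOL-Analysis.Analysis"
begin

section \<open>Complex threefolds in projective space\<close>

text \<open>
  All varieties below are compact complex submanifolds of a projective space. By the theorems
  of Chow and Serre (GAGA) these are the same thing as smooth projective varieties, with the same
  line bundles, global sections, effective divisors and automorphisms.
  A point of the projective space of \<open>complex ^ 'i\<close> is a line through the origin, i.e. the
  span of a nonzero vector.
\<close>

type_synonym 'i ppt = "(complex ^ 'i) set"

definition pt :: "complex ^ 'i \<Rightarrow> 'i ppt" where
  "pt x = vec.span {x}"

definition proj_topology :: "'i::finite ppt topology" where
  "proj_topology = topology (\<lambda>T. T \<subseteq> pt ` (- {0}) \<and> open {x. x \<noteq> 0 \<and> pt x \<in> T})"

lemma openin_proj_topology:
  "openin proj_topology T \<longleftrightarrow> T \<subseteq> pt ` (- {0}) \<and> open {x :: complex ^ 'i::finite. x \<noteq> 0 \<and> pt x \<in> T}"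
proof -
  let ?L = "\<lambda>T :: 'i ppt set. T \<subseteq> pt ` (- {0}) \<and> open {x :: complex ^ 'i. x \<noteq> 0 \<and> pt x \<in> T}"
  have "istopology ?L"
    unfolding istopology_def
  proof (intro conjI allI impI; (elim conjE)?)
    fix S T :: "'i ppt set"
    assume "open {x. x \<noteq> 0 \<and> pt x \<in> S}" "open {x. x \<noteq> 0 \<and> pt x \<in> T}"
    then have "open ({x. x \<noteq> 0 \<and> pt x \<in> S} \<inter> {x. x \<noteq> 0 \<and> pt x \<in> T})" by blast
    also have "{x. x \<noteq> 0 \<and> pt x \<in> S} \<inter> {x. x \<noteq> 0 \<and> pt x \<in> T} = {x. x \<noteq> 0 \<and> pt x \<in> S \<inter> T}"
      by blast
    finally show "open {x. x \<noteq> 0 \<and> pt x \<in> S \<inter> T}" .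
  next
    fix K :: "'i ppt set set"
    assume *: "\<forall>S\<in>K. ?L S"
    then have "open (\<Union>S\<in>K. {x. x \<noteq> 0 \<and> pt x \<in> S})" by blast
    also have "(\<Union>S\<in>K. {x. x \<noteq> 0 \<and> pt x \<in> S}) = {x. x \<noteq> 0 \<and> pt x \<in> \<Union>K}" by blast
    finally show "open {x. x \<noteq> 0 \<and> pt x \<in> \<Union>K}" .
  qed blast+
  then show ?thesis
    by (simp add: proj_topology_def topology_inverse')
qed

abbreviation (input) top_on :: "'i::finite ppt set \<Rightarrow> 'i ppt topology" where
  "top_on X \<equiv> subtopology proj_topology X"

text \<open>Every chart has the unit ball as its domain, so that every line bundle is trivial on it.\<close>

abbreviation UB :: "(complex ^ 3) set" where
  "UB \<equiv> ball 0 1"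

definition holo :: "(complex ^ 3) set \<Rightarrow> (complex ^ 3 \<Rightarrow> complex) \<Rightarrow> bool" where
  "holo D f \<longleftrightarrow> (\<forall>z\<in>D. \<exists>a :: complex ^ 3. (f has_derivative (\<lambda>v. \<Sum>j\<in>UNIV. a $ j * v $ j)) (at z))"

definition partial :: "(complex ^ 3 \<Rightarrow> complex) \<Rightarrow> 3 \<Rightarrow> complex ^ 3 \<Rightarrow> complex" where
  "partial f j z = frechet_derivative f (at z) (axis j 1)"

text \<open>
  The map with homogeneous coordinates \<open>F k\<close>, \<open>k \<in> K\<close>, is defined at \<open>z\<close> and has injective
  differential there iff the vectors \<open>F\<close> and its three partial derivatives are linearly independent.
\<close>

definition proj_immersive :: "'k set \<Rightarrow> ('k \<Rightarrow> complex ^ 3 \<Rightarrow> complex) \<Rightarrow> complex ^ 3 \<Rightarrow> bool" where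
  "proj_immersive K F z \<longleftrightarrow>
     (\<forall>(a :: complex) (b :: complex ^ 3).
        (\<forall>k\<in>K. a * F k z + (\<Sum>j\<in>UNIV. b $ j * partial (F k) j z) = 0) \<longrightarrow> a = 0 \<and> b = 0)"

definition lifts :: "(complex ^ 3 \<Rightarrow> 'i::finite ppt) \<Rightarrow> (complex ^ 3 \<Rightarrow> complex ^ 'i) \<Rightarrow> bool" where
  "lifts \<phi> F \<longleftrightarrow> (\<forall>i. holo UB (\<lambda>z. F z $ i)) \<and> (\<forall>z\<in>UB. F z \<noteq> 0 \<and> \<phi> z = pt (F z))"

definition charts :: "'i::finite ppt set \<Rightarrow> (complex ^ 3 \<Rightarrow> 'i ppt) set" where
  "charts X = {\<phi>. \<phi> ` UB \<subseteq> X \<and> openin (top_on X) (\<phi> ` UB) \<and>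
                  embedding_map (top_of_set UB) (top_on X) \<phi> \<and>
                  (\<exists>F. lifts \<phi> F \<and> (\<forall>z\<in>UB. proj_immersive UNIV (\<lambda>i z. F z $ i) z))}"

definition smooth_threefold :: "'i::finite ppt set \<Rightarrow> bool" where
  "smooth_threefold X \<longleftrightarrow> X \<noteq> {} \<and> X \<subseteq> pt ` (- {0}) \<and> compact_space (top_on X) \<and>
     connected_space (top_on X) \<and> (\<forall>p\<in>X. \<exists>\<phi>\<in>charts X. p \<in> \<phi> ` UB)"

definition overlap :: "(complex ^ 3 \<Rightarrow> 'p) \<Rightarrow> (complex ^ 3 \<Rightarrow> 'p) \<Rightarrow> (complex ^ 3) set" where
  "overlap \<phi> \<psi> = {z \<in> UB. \<phi> z \<in> \<psi> ` UB}"

definition transition :: "(complex ^ 3 \<Rightarrow> 'p) \<Rightarrow> (complex ^ 3 \<Rightarrow> 'p) \<Rightarrow> complex ^ 3 \<Rightarrow> complex ^ 3" where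
  "transition \<phi> \<psi> z = inv_into UB \<psi> (\<phi> z)"


section \<open>Line bundles, sections and divisors\<close>

text \<open>
  A line bundle is given by transition functions \<open>g \<phi> \<psi> z\<close> over all pairs of charts; the local
  expressions of a section satisfy \<open>s\<^sub>\<psi> = g\<^sub>\<phi>\<^sub>\<psi> s\<^sub>\<phi>\<close> on overlaps.
\<close>

type_synonym 'i chart = "complex ^ 3 \<Rightarrow> 'i ppt"
type_synonym 'i cocycle = "'i chart \<Rightarrow> 'i chart \<Rightarrow> complex ^ 3 \<Rightarrow> complex"
type_synonym 'i sect = "'i chart \<Rightarrow> complex ^ 3 \<Rightarrow> complex"
type_synonym 'i divisor = "'i chart \<Rightarrow> (complex ^ 3 \<Rightarrow> complex) set"

definition line_bundle :: "'i::finite ppt set \<Rightarrow> 'i cocycle \<Rightarrow> bool" where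
  "line_bundle X g \<longleftrightarrow>
     (\<forall>\<phi>\<in>charts X. \<forall>\<psi>\<in>charts X. holo (overlap \<phi> \<psi>) (g \<phi> \<psi>) \<and> (\<forall>z\<in>overlap \<phi> \<psi>. g \<phi> \<psi> z \<noteq> 0)) \<and>
     (\<forall>\<phi>\<in>charts X. \<forall>\<psi>\<in>charts X. \<forall>\<theta>\<in>charts X. \<forall>z\<in>overlap \<phi> \<psi> \<inter> overlap \<phi> \<theta>.
        g \<psi> \<theta> (transition \<phi> \<psi> z) * g \<phi> \<psi> z = g \<phi> \<theta> z)"

definition bundle_iso :: "'i::finite ppt set \<Rightarrow> 'i cocycle \<Rightarrow> 'i cocycle \<Rightarrow> bool" where
  "bundle_iso X g g' \<longleftrightarrow>
     (\<exists>h :: 'i sect. (\<forall>\<phi>\<in>charts X. holo UB (h \<phi>) \<and> (\<forall>z\<in>UB. h \<phi> z \<noteq> 0)) \<and>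
        (\<forall>\<phi>\<in>charts X. \<forall>\<psi>\<in>charts X. \<forall>z\<in>overlap \<phi> \<psi>.
           h \<psi> (transition \<phi> \<psi> z) * g \<phi> \<psi> z = g' \<phi> \<psi> z * h \<phi> z))"

definition bundle_power :: "'i cocycle \<Rightarrow> int \<Rightarrow> 'i cocycle" where
  "bundle_power g n = (\<lambda>\<phi> \<psi> z. g \<phi> \<psi> z powi n)"

definition sections :: "'i::finite ppt set \<Rightarrow> 'i cocycle \<Rightarrow> 'i sect set" where
  "sections X g = {s.
     (\<forall>\<phi>\<in>charts X. holo UB (s \<phi>)) \<and>
     (\<forall>\<phi>\<in>charts X. \<forall>\<psi>\<in>charts X. \<forall>z\<in>overlap \<phi> \<psi>. s \<psi> (transition \<phi> \<psi> z) = g \<phi> \<psi> z * s \<phi> z) \<and>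
     (\<forall>\<phi> z. \<phi> \<notin> charts X \<or> z \<notin> UB \<longrightarrow> s \<phi> z = 0)}"

text \<open>
  The anticanonical bundle, the top exterior power of the tangent bundle: with \<open>w\<close> the coordinates
  of the second chart, \<open>\<partial>z\<^sub>1 \<and> \<partial>z\<^sub>2 \<and> \<partial>z\<^sub>3 = det (\<partial>w / \<partial>z) \<partial>w\<^sub>1 \<and> \<partial>w\<^sub>2 \<and> \<partial>w\<^sub>3\<close>.
\<close>

definition anticanonical :: "'i::finite cocycle" where
  "anticanonical \<phi> \<psi> z = det (matrix (frechet_derivative (transition \<phi> \<psi>) (at z)))"

definition very_ample :: "'i::finite ppt set \<Rightarrow> 'i cocycle \<Rightarrow> bool" where
  "very_ample X g \<longleftrightarrow>
     (\<exists>(N :: nat) (s :: nat \<Rightarrow> 'i sect). (\<forall>k\<le>N. s k \<in> sections X g) \<and>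
        (\<forall>\<phi>\<in>charts X. \<forall>z\<in>UB. proj_immersive {..N} (\<lambda>k. s k \<phi>) z) \<and>
        (\<forall>\<phi>\<in>charts X. \<forall>\<psi>\<in>charts X. \<forall>z\<in>UB. \<forall>w\<in>UB. \<forall>c. c \<noteq> 0 \<longrightarrow>
           (\<forall>k\<le>N. s k \<phi> z = c * s k \<psi> w) \<longrightarrow> \<phi> z = \<psi> w))"

definition ample :: "'i::finite ppt set \<Rightarrow> 'i cocycle \<Rightarrow> bool" where
  "ample X g \<longleftrightarrow> (\<exists>m>0. very_ample X (bundle_power g m))"

text \<open>
  The triple self-intersection number \<open>d\<close> of an ample bundle: if three sections of the \<open>m\<close>-th power
  (\<open>m > 0\<close>) have only transversal common zeros, then their number is \<open>m\<^sup>3 d\<close>; by Bertini such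
  sections exist as soon as the \<open>m\<close>-th power is very ample.
\<close>

definition has_cube :: "'i::finite ppt set \<Rightarrow> 'i cocycle \<Rightarrow> real \<Rightarrow> bool" where
  "has_cube X g d \<longleftrightarrow>
     (\<exists>(m :: nat) (s :: 3 \<Rightarrow> 'i sect). m > 0 \<and> (\<forall>i. s i \<in> sections X (bundle_power g (int m))) \<and>
        (\<forall>\<phi>\<in>charts X. \<forall>z\<in>UB. (\<forall>i. s i \<phi> z = 0) \<longrightarrow> det (\<chi> i j. partial (s i \<phi>) j z) \<noteq> 0) \<and>
        finite {p. \<exists>\<phi>\<in>charts X. \<exists>z\<in>UB. p = \<phi> z \<and> (\<forall>i. s i \<phi> z = 0)} \<and>
        real (card {p. \<exists>\<phi>\<in>charts X. \<exists>z\<in>UB. p = \<phi> z \<and> (\<forall>i. s i \<phi> z = 0)}) = real m ^ 3 * d)"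

text \<open>
  An effective divisor is recorded by the set of its local equations on each chart; they are unique
  up to nowhere vanishing holomorphic factors.
\<close>

definition divisor :: "'i::finite ppt set \<Rightarrow> 'i sect \<Rightarrow> 'i divisor" where
  "divisor X s = (\<lambda>\<phi>. if \<phi> \<in> charts X
     then {f. \<exists>u. holo UB u \<and> (\<forall>z\<in>UB. u z \<noteq> 0) \<and> f = (\<lambda>z. if z \<in> UB then u z * s \<phi> z else 0)}
     else {})"

definition linear_system :: "'i::finite ppt set \<Rightarrow> 'i cocycle \<Rightarrow> 'i divisor set" where
  "linear_system X g = divisor X ` (sections X g - {\<lambda>_ _. 0})"

definition section_comb :: "('n::finite \<Rightarrow> 'i sect) \<Rightarrow> complex ^ 'n \<Rightarrow> 'i sect" where
  "section_comb b c = (\<lambda>\<phi> z. \<Sum>k\<in>UNIV. c $ k * b k \<phi> z)"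

definition line_in_system :: "'i::finite ppt set \<Rightarrow> 'i cocycle \<Rightarrow> 'i divisor set \<Rightarrow> bool" where
  "line_in_system X g L \<longleftrightarrow>
     (\<exists>b :: 2 \<Rightarrow> 'i sect. (\<forall>k. b k \<in> sections X g) \<and> inj (section_comb b) \<and>
        L = {divisor X (section_comb b c) |c. c \<noteq> 0})"


section \<open>Mukai threefolds and automorphisms\<close>

definition mukai_threefold :: "'i::finite ppt set \<Rightarrow> bool" where
  "mukai_threefold X \<longleftrightarrow> smooth_threefold X \<and> ample X anticanonical \<and>
     (\<forall>g. line_bundle X g \<longrightarrow> (\<exists>n. bundle_iso X g (bundle_power anticanonical n))) \<and>
     (\<exists>d. has_cube X anticanonical d \<and> 1 / 2 * d + 1 = 12)"

text \<open>A bijection is biholomorphic iff it and its inverse carry charts to charts.\<close>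

definition Aut :: "'i::finite ppt set \<Rightarrow> ('i ppt \<Rightarrow> 'i ppt) set" where
  "Aut X = {f \<in> extensional X. bij_betw f X X \<and>
              (\<forall>\<phi>. \<phi> ` UB \<subseteq> X \<longrightarrow> (\<phi> \<in> charts X \<longleftrightarrow> f \<circ> \<phi> \<in> charts X))}"

text \<open>
  As the automorphism group of a compact complex manifold is a Lie group for the compact-open
  topology, its identity component is the path component of the identity.
\<close>

definition Aut0 :: "'i::finite ppt set \<Rightarrow> ('i ppt \<Rightarrow> 'i ppt) set" where
  "Aut0 X = {f. \<exists>h :: real \<Rightarrow> 'i ppt \<Rightarrow> 'i ppt.
      (\<forall>r\<in>{0..1}. h r \<in> Aut X) \<and> h 0 = restrict id X \<and> h 1 = f \<and>
      continuous_map (prod_topology (top_of_set {0..1}) (top_on X)) (top_on X) (\<lambda>(r, p). h r p)}"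

text \<open>A bijective continuous homomorphism onto a Lie group is an isomorphism of Lie groups.\<close>

definition Cstar_iso_Aut0 :: "'i::finite ppt set \<Rightarrow> (complex \<Rightarrow> 'i ppt \<Rightarrow> 'i ppt) \<Rightarrow> bool" where
  "Cstar_iso_Aut0 X \<rho> \<longleftrightarrow> bij_betw \<rho> (- {0}) (Aut0 X) \<and>
     (\<forall>s t. s \<noteq> 0 \<longrightarrow> t \<noteq> 0 \<longrightarrow> \<rho> (s * t) = compose X (\<rho> s) (\<rho> t)) \<and>
     continuous_map (prod_topology (top_of_set (- {0})) (top_on X)) (top_on X) (\<lambda>(s, p). \<rho> s p)"

text \<open>The local equations of the pullback \<open>f\<^sup>*D\<close> on \<open>\<phi>\<close> are those of \<open>D\<close> on \<open>f \<circ> \<phi>\<close>.\<close>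

definition invariant_divisor ::
    "'i::finite ppt set \<Rightarrow> (complex \<Rightarrow> 'i ppt \<Rightarrow> 'i ppt) \<Rightarrow> 'i divisor \<Rightarrow> bool" where
  "invariant_divisor X \<rho> D \<longleftrightarrow> (\<forall>s. s \<noteq> 0 \<longrightarrow> (\<forall>\<phi>\<in>charts X. D (\<rho> s \<circ> \<phi>) = D \<phi>))"

text \<open>
  \<open>X\<close> lies in the projective space of \<open>U\<close>, and the inclusion is the embedding by the complete
  anticanonical system: there is an isomorphism of \<open>O(1)\<close> with the anticanonical bundle (given by
  the choice of the lifts \<open>F\<close>) under which restriction to \<open>X\<close> is a bijection from the linear forms on
  \<open>U\<close> to the anticanonical sections. Injectivity is expressed by \<open>X\<close> spanning \<open>U\<close>.
\<close>

definition anticanonically_embedded :: "'i::finite ppt set \<Rightarrow> (complex ^ 'i) set \<Rightarrow> bool" where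
  "anticanonically_embedded X U \<longleftrightarrow> vec.span (\<Union>X) = U \<and>
     (\<exists>F. (\<forall>\<phi>\<in>charts X. lifts \<phi> (F \<phi>)) \<and>
        sections X anticanonical =
          {(\<lambda>\<phi> z. if \<phi> \<in> charts X \<and> z \<in> UB then \<Sum>i\<in>UNIV. l $ i * F \<phi> z $ i else 0)
             |l :: complex ^ 'i. True})"


section \<open>The family \<open>V\<^sup>a\<close>\<close>

typedef idx = "{-3..3 :: int}"
  morphisms wt idx
  by auto

instance idx :: finite
proof
  have "(UNIV :: idx set) = idx ` {-3..3}"
    by (metis UNIV_eq_I wt wt_inverse imageI)
  then show "finite (UNIV :: idx set)" by (metis finite_atLeastAtMost_int finite_imageI)
qed

text \<open>
  The exterior algebra of \<open>W\<^sub>7\<close>: the coordinate of index \<open>S\<close> belongs to the wedge product of the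
  basis vectors \<open>e j\<close>, \<open>j \<in> S\<close>, taken in increasing order.
\<close>

type_synonym ext = "complex ^ idx set"

definition shuffle_sign :: "idx set \<Rightarrow> idx set \<Rightarrow> complex" where
  "shuffle_sign A B = (- 1) ^ card {(a, b). a \<in> A \<and> b \<in> B \<and> wt b < wt a}"

definition wedge :: "ext \<Rightarrow> ext \<Rightarrow> ext"  (infixr "\<and>\<^sub>W" 70) where
  "x \<and>\<^sub>W y = (\<chi> S. \<Sum>A\<in>Pow S. shuffle_sign A (S - A) * x $ A * y $ (S - A))"

definition grade :: "nat \<Rightarrow> ext set" where
  "grade k = {x. \<forall>S. card S \<noteq> k \<longrightarrow> x $ S = 0}"

definition e :: "int \<Rightarrow> ext" where
  "e j = axis {idx j} 1"

definition net :: "complex \<Rightarrow> ext set" where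
  "net \<tau> = vec.span
     {e 0 \<and>\<^sub>W e 1 + e (-1) \<and>\<^sub>W e 2 + e (-2) \<and>\<^sub>W e 3,
      e (-1) \<and>\<^sub>W e 1 + e (-2) \<and>\<^sub>W e 2 + \<tau> *s (e (-3) \<and>\<^sub>W e 3),
      e (-1) \<and>\<^sub>W e 0 + e (-2) \<and>\<^sub>W e 1 + e (-3) \<and>\<^sub>W e 2}"

definition annihilated :: "complex \<Rightarrow> ext set" where
  "annihilated \<tau> = {x \<in> grade 4. \<forall>\<omega>\<in>net \<tau>. x \<and>\<^sub>W \<omega> = 0}"

definition grassmannian4 :: "idx set ppt set" where
  "grassmannian4 = {pt (u \<and>\<^sub>W v \<and>\<^sub>W w \<and>\<^sub>W x) |u v w x.
     {u, v, w, x} \<subseteq> grade 1 \<and> u \<and>\<^sub>W v \<and>\<^sub>W w \<and>\<^sub>W x \<noteq> 0}"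

definition Va_model :: "complex \<Rightarrow> idx set ppt set" where
  "Va_model \<tau> = {p \<in> grassmannian4. p \<subseteq> annihilated \<tau>}"

text \<open>The action on the exterior algebra induced by \<open>e j \<mapsto> s\<^sup>j e j\<close>.\<close>

definition ext_action :: "complex \<Rightarrow> ext \<Rightarrow> ext" where
  "ext_action s x = (\<chi> S. s powi (\<Sum>j\<in>S. wt j) * x $ S)"

definition torus :: "idx set ppt set \<Rightarrow> complex \<Rightarrow> idx set ppt \<Rightarrow> idx set ppt" where
  "torus X s = (\<lambda>p\<in>X. ext_action s ` p)"

text \<open>
  The second condition says both that the identity component of the automorphism group is a copy of
  the multiplicative group, and that the torus action is the action of this component.
\<close>

definition family_Va :: "idx set ppt set set" where
  "family_Va = {V. mukai_threefold V \<and> Cstar_iso_Aut0 V (torus V) \<and>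
     (\<exists>\<tau>. V = Va_model \<tau> \<and> anticanonically_embedded V (annihilated \<tau>))}"

end

theory Submission
  imports Defs "HOL-Complex_Analysis.Conformal_Mappings"
    "HOL-Computational_Algebra.Fundamental_Theorem_Algebra"
begin

text \<open>
  Anticanonical sections are the linear forms on the span \<open>U\<close> of \<open>V\<close>, so the torus acts on them
  diagonally. If two weight parts of a form \<open>l\<close> are nonzero at a point \<open>x\<close> of \<open>V\<close>, then \<open>l\<close> vanishes
  somewhere on the orbit of \<open>x\<close> without vanishing on all of it, so that its divisor is not invariant;
  as \<open>V\<close> is irreducible, an invariant divisor is therefore cut out by a form of a single weight.
  Forms of different weights have different divisors: otherwise their ratio would be bounded on the
  compact \<open>V\<close>, whereas along an orbit it is a nonzero power of the parameter. Solving the equations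
  of \<open>U\<close> weight by weight shows that for every \<open>\<tau>\<close> the weights are \<open>-6, \<dots>, 6\<close>, each of multiplicity
  one, except that weight \<open>0\<close> has multiplicity two.
\<close>

section \<open>Points of projective space and their nonzero representatives\<close>

lemma pt_nonzero_unique:
  assumes "x \<in> pt y" "x \<noteq> 0"
  obtains c where "c \<noteq> 0" "x = c *s y"
proof -
  from assms(1) obtain c where "x = c *s y"
    by (auto simp: pt_def vec.span_singleton)
  with assms(2) show thesis
    by (intro that[of c]) auto
qed

lemma self_in_pt: "x \<in> pt x"
  by (simp add: pt_def vec.span_base)

lemma topspace_proj_topology: "topspace proj_topology = pt ` (- {0})"
proof
  show "topspace proj_topology \<subseteq> pt ` (- {0})"
    using openin_topspace[of proj_topology] unfolding openin_proj_topology by blast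
  have "{x :: complex ^ 'a. x \<noteq> 0 \<and> pt x \<in> pt ` (- {0})} = - {0}" by auto
  then have "openin (proj_topology :: 'a ppt topology) (pt ` (- {0}))"
    unfolding openin_proj_topology by auto
  then show "pt ` (- {0}) \<subseteq> topspace (proj_topology :: 'a ppt topology)"
    by (rule openin_subset)
qed

section \<open>Holomorphic functions\<close>

lemma holo_imp_continuous_on: "holo D f \<Longrightarrow> continuous_on D f"
  unfolding holo_def
  by (meson continuous_at_imp_continuous_on has_derivative_continuous)

lemma holo_mult:
  assumes "holo D f" "holo D g" shows "holo D (\<lambda>z. f z * g z)"
  unfolding holo_def
proof
  fix z assume z: "z \<in> D"
  from assms z obtain a b :: "complex ^ 3" where
    "(f has_derivative (\<lambda>v. \<Sum>j\<in>UNIV. a $ j * v $ j)) (at z)"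
    "(g has_derivative (\<lambda>v. \<Sum>j\<in>UNIV. b $ j * v $ j)) (at z)"
    unfolding holo_def by blast
  from has_derivative_mult[OF this]
  have "((\<lambda>z. f z * g z) has_derivative
      (\<lambda>v. \<Sum>j\<in>UNIV. (f z *s b + g z *s a) $ j * v $ j)) (at z)"
    by (rule has_derivative_eq_rhs)
      (auto simp: sum_distrib_left sum_distrib_right sum.distrib algebra_simps)
  then show "\<exists>a. ((\<lambda>z. f z * g z) has_derivative (\<lambda>v. \<Sum>j\<in>UNIV. a $ j * v $ j)) (at z)"
    by blast
qed

lemma holo_inverse:
  assumes "holo D f" "\<And>z. z \<in> D \<Longrightarrow> f z \<noteq> 0" shows "holo D (\<lambda>z. inverse (f z))"
  unfolding holo_def
proof
  fix z assume z: "z \<in> D"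
  from assms z obtain a :: "complex ^ 3" where
    "(f has_derivative (\<lambda>v. \<Sum>j\<in>UNIV. a $ j * v $ j)) (at z)"
    unfolding holo_def by blast
  from Deriv.has_derivative_inverse[OF assms(2)[OF z] this]
  have "((\<lambda>z. inverse (f z)) has_derivative
      (\<lambda>v. \<Sum>j\<in>UNIV. ((- inverse (f z) * inverse (f z)) *s a) $ j * v $ j)) (at z)"
    by (rule has_derivative_eq_rhs)
      (auto simp: sum_distrib_left sum_distrib_right sum_negf algebra_simps)
  then show "\<exists>a. ((\<lambda>z. inverse (f z)) has_derivative (\<lambda>v. \<Sum>j\<in>UNIV. a $ j * v $ j)) (at z)"
    by blast
qed

lemma holo_const: "holo D (\<lambda>z. c)"
  unfolding holo_def
proof
  fix z :: "complex ^ 3"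
  have "((\<lambda>z. c) has_derivative (\<lambda>v. \<Sum>j\<in>UNIV. (0 :: complex ^ 3) $ j * v $ j)) (at z)"
    by simp
  then show "\<exists>a :: complex ^ 3. ((\<lambda>z. c) has_derivative (\<lambda>v. \<Sum>j\<in>UNIV. a $ j * v $ j)) (at z)"
    by blast
qed

lemma holo_local:
  assumes "\<And>z. z \<in> D \<Longrightarrow> \<exists>T g. open T \<and> z \<in> T \<and> holo (D \<inter> T) g \<and> (\<forall>w\<in>T. f w = g w)"
  shows "holo D f"
  unfolding holo_def
proof
  fix z assume z: "z \<in> D"
  from assms[OF z] obtain T g where T: "open T" "z \<in> T" "holo (D \<inter> T) g" "\<forall>w\<in>T. f w = g w"
    by blast
  then obtain a :: "complex ^ 3" where "(g has_derivative (\<lambda>v. \<Sum>j\<in>UNIV. a $ j * v $ j)) (at z)"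
    using z unfolding holo_def by blast
  then have "(f has_derivative (\<lambda>v. \<Sum>j\<in>UNIV. a $ j * v $ j)) (at z)"
    by (rule has_derivative_transform_within_open[OF _ T(1,2)]) (use T(4) in auto)
  then show "\<exists>a. (f has_derivative (\<lambda>v. \<Sum>j\<in>UNIV. a $ j * v $ j)) (at z)" by blast
qed

text \<open>Restriction to complex lines, by which one-variable complex analysis reaches functions
  of three variables.\<close>

lemma holo_on_complex_line:
  assumes f: "holo D f" and S: "\<And>\<zeta>. \<zeta> \<in> S \<Longrightarrow> p + \<zeta> *s v \<in> D"
  shows "(\<lambda>\<zeta>. f (p + \<zeta> *s v)) holomorphic_on S"
  unfolding holomorphic_on_def
proof
  fix \<zeta> assume "\<zeta> \<in> S"
  then obtain a :: "complex ^ 3" where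
    a: "(f has_derivative (\<lambda>v. \<Sum>j\<in>UNIV. a $ j * v $ j)) (at (p + \<zeta> *s v))"
    using f S unfolding holo_def by blast
  have "bounded_linear (\<lambda>\<zeta> :: complex. \<zeta> *s v)"
    by (rule linear_conv_bounded_linear[THEN iffD1], rule linearI)
      (auto simp: vec_eq_iff algebra_simps)
  then have "((\<lambda>\<zeta>. p + \<zeta> *s v) has_derivative (\<lambda>h. h *s v)) (at \<zeta>)"
    using has_derivative_add[OF has_derivative_const bounded_linear_imp_has_derivative] by force
  from has_derivative_compose[OF this a]
  have "((\<lambda>\<zeta>. f (p + \<zeta> *s v)) has_derivative (*) (\<Sum>j\<in>UNIV. a $ j * v $ j)) (at \<zeta>)"
    by (rule has_derivative_eq_rhs) (auto simp: sum_distrib_left sum_distrib_right algebra_simps)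
  then have "((\<lambda>\<zeta>. f (p + \<zeta> *s v)) has_field_derivative (\<Sum>j\<in>UNIV. a $ j * v $ j)) (at \<zeta>)"
    by (simp add: has_field_derivative_def)
  then show "(\<lambda>\<zeta>. f (p + \<zeta> *s v)) field_differentiable at \<zeta> within S"
    using field_differentiable_at_within field_differentiable_def by blast
qed

text \<open>The complex line through a point of \<open>W\<close> and \<open>z\<close> meets the
  convex set \<open>D\<close> in a connected open set of parameters, so one-variable analytic
  continuation carries the zeros from \<open>W\<close> to \<open>z\<close>.\<close>

lemma holo_identity_theorem:
  assumes f: "holo D f" and D: "open D" "convex D"
    and W: "open W" "W \<noteq> {}" "W \<subseteq> D" "\<And>z. z \<in> W \<Longrightarrow> f z = 0" and z: "z \<in> D"
  shows "f z = 0"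
proof -
  from W obtain p where p: "p \<in> W" by blast
  let ?g = "\<lambda>\<zeta> :: complex. p + \<zeta> *s (z - p)"
  let ?S = "?g -` D"
  have scl: "linear (\<lambda>\<zeta> :: complex. \<zeta> *s (z - p))"
    by (rule linearI) (auto simp: vec_eq_iff algebra_simps)
  then have "continuous_on UNIV ?g"
    by (intro continuous_intros linear_continuous_on) (simp add: linear_conv_bounded_linear)
  then have opn: "open (?g -` A)" if "open A" for A
    using that by (simp add: continuous_on_open_vimage)
  \<comment> \<open>The map \<open>?g\<close> is only affine; translating \<open>D\<close> by
    \<open>-p\<close> exhibits \<open>?S\<close> as the preimage of a convex set under a linear
    map.\<close>
  have "?S = (\<lambda>\<zeta>. \<zeta> *s (z - p)) -` ((+) (-p) ` D)"
    by (auto simp: image_iff) (metis add.commute add_uminus_conv_diff diff_add_cancel)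
  then have "convex ?S"
    using scl D(2) by (simp add: convex_linear_vimage convex_translation)
  then have con: "connected ?S" by (rule convex_connected)
  have "?g 1 = z" by (simp add: vec_eq_iff)
  then have one: "1 \<in> ?S" using z by simp
  have zero: "0 \<in> ?g -` W" "0 \<in> ?S" using p W(3) by auto
  have "f (?g 1) = 0"
  proof (rule analytic_continuation_open[of "?g -` W" ?S "\<lambda>\<zeta>. f (?g \<zeta>)" "\<lambda>_. 0"])
    show "open (?g -` W)" "open ?S" using opn W D by auto
    show "?g -` W \<noteq> {}" using zero by blast
    show "connected ?S" by (rule con)
    show "?g -` W \<subseteq> ?S" using W by auto
    show "(\<lambda>\<zeta>. f (?g \<zeta>)) holomorphic_on ?S" by (rule holo_on_complex_line[OF f]) simp
  qed (use W one in auto)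
  with \<open>?g 1 = z\<close> show ?thesis by simp
qed

section \<open>Projective threefolds whose sections are the linear forms\<close>

definition lin :: "complex ^ 'i::finite \<Rightarrow> complex ^ 'i \<Rightarrow> complex" where
  "lin l x = (\<Sum>i\<in>UNIV. l $ i * x $ i)"

lemma lin_add_right: "lin l (x + y) = lin l x + lin l y"
  by (simp add: lin_def algebra_simps sum.distrib)

lemma lin_scale_right: "lin l (c *s x) = c * lin l x"
  by (simp add: lin_def algebra_simps sum_distrib_left)

lemma lin_scale_left: "lin (c *s l) x = c * lin l x"
  by (simp add: lin_def algebra_simps sum_distrib_left)

lemma lin_sum_left: "lin (\<Sum>k\<in>A. f k) x = (\<Sum>k\<in>A. lin (f k) x)"
  by (simp add: lin_def sum_distrib_right) (rule sum.swap)

lemma lin_sum_right: "lin l (\<Sum>k\<in>A. f k) = (\<Sum>k\<in>A. lin l (f k))"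
  by (simp add: lin_def sum_distrib_left) (rule sum.swap)

lemma lin_zero_left [simp]: "lin 0 x = 0"
  by (simp add: lin_def)

lemma lin_axis_left [simp]: "lin (axis i 1) x = x $ i"
  by (simp add: lin_def axis_def if_distrib[of "\<lambda>t. t * _"] cong: if_cong)

lemma holo_lin:
  assumes "\<And>i. holo D (\<lambda>z. F z $ i)" shows "holo D (\<lambda>z. lin l (F z))"
  unfolding holo_def
proof
  fix z assume "z \<in> D"
  with assms have "\<forall>i. \<exists>a :: complex ^ 3. ((\<lambda>z. F z $ i) has_derivative (\<lambda>v. \<Sum>j\<in>UNIV. a $ j * v $ j)) (at z)"
    unfolding holo_def by blast
  then obtain a :: "'a \<Rightarrow> complex ^ 3" where
    a: "\<And>i. ((\<lambda>z. F z $ i) has_derivative (\<lambda>v. \<Sum>j\<in>UNIV. a i $ j * v $ j)) (at z)"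
    by metis
  have "((\<lambda>z. lin l (F z)) has_derivative (\<lambda>v. \<Sum>i\<in>UNIV. l $ i * (\<Sum>j\<in>UNIV. a i $ j * v $ j))) (at z)"
    unfolding lin_def by (intro has_derivative_sum has_derivative_mult_right a)
  also have "(\<lambda>v. \<Sum>i\<in>UNIV. l $ i * (\<Sum>j\<in>UNIV. a i $ j * v $ j)) =
      (\<lambda>v. \<Sum>j\<in>UNIV. (\<Sum>i\<in>UNIV. l $ i *s a i) $ j * v $ j)"
    by (simp add: sum_distrib_left sum_distrib_right mult.assoc) (subst sum.swap, simp)
  finally show "\<exists>a. ((\<lambda>z. lin l (F z)) has_derivative (\<lambda>v. \<Sum>j\<in>UNIV. a $ j * v $ j)) (at z)"
    by blast
qed

lemma lifts_holo_lin: "lifts \<phi> F \<Longrightarrow> holo UB (\<lambda>z. lin l (F z))"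
  unfolding lifts_def by (intro holo_lin) blast

lemma holo_open_preimage:
  assumes "holo UB f" "open T" shows "open {z \<in> UB. f z \<in> T}"
  using continuous_open_preimage[OF holo_imp_continuous_on[OF assms(1)] open_ball assms(2)]
  by (simp add: vimage_def Int_def)

text \<open>Near a point where the \<open>i\<close>-th coordinate of \<open>F\<close> does not vanish, the factor is the ratio of the
  \<open>i\<close>-th coordinates, hence holomorphic.\<close>

lemma proportional_lifts:
  assumes F: "\<And>i. holo UB (\<lambda>z. F z $ i)" and G: "\<And>i. holo UB (\<lambda>z. G z $ i)"
    and ratio: "\<And>z. z \<in> UB \<Longrightarrow> \<exists>c. c \<noteq> 0 \<and> G z = c *s F z" and nz: "\<And>z. z \<in> UB \<Longrightarrow> F z \<noteq> 0"
  obtains c where "holo UB c" "\<And>z. z \<in> UB \<Longrightarrow> c z \<noteq> 0" "\<And>z. z \<in> UB \<Longrightarrow> G z = c z *s F z"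
proof -
  from ratio obtain c where c: "\<And>z. z \<in> UB \<Longrightarrow> c z \<noteq> 0 \<and> G z = c z *s F z" by metis
  have "holo UB c"
  proof (rule holo_local)
    fix z :: "complex ^ 3" assume z: "z \<in> UB"
    from nz[OF z] obtain i where i: "F z $ i \<noteq> 0" by (auto simp: vec_eq_iff)
    let ?T = "{w \<in> UB. F w $ i \<in> - {0}}"
    have T: "open ?T"
      by (intro holo_open_preimage F) auto
    have sub: "holo (UB \<inter> ?T) f" if "holo UB f" for f
      using that unfolding holo_def by blast
    have "holo (UB \<inter> ?T) (\<lambda>w. G w $ i * inverse (F w $ i))"
      by (intro holo_mult holo_inverse sub F G) auto
    moreover have "c w = G w $ i * inverse (F w $ i)" if "w \<in> ?T" for w
      using that c[of w] by auto
    ultimately show "\<exists>T g. open T \<and> z \<in> T \<and> holo (UB \<inter> T) g \<and> (\<forall>w\<in>T. c w = g w)"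
      using T z i by (intro exI[of _ ?T] exI[of _ "\<lambda>w. G w $ i * inverse (F w $ i)"]) auto
  qed
  with c that show thesis by blast
qed

text \<open>Charts are open embeddings, so open conditions on the ball define open sets of
  \<open>X\<close>; the later uses of connectedness and compactness rest on this.\<close>

lemma chart_open_image:
  assumes "\<phi> \<in> charts X" "open W" "W \<subseteq> UB"
  shows "openin (top_on X) (\<phi> ` W)"
proof -
  have op: "openin (top_on X) (\<phi> ` UB)" and
    hom: "homeomorphic_map (top_of_set UB) (subtopology (top_on X) (\<phi> ` UB)) \<phi>"
    using assms(1) by (auto simp: charts_def embedding_map_def)
  have "openin (top_of_set UB) W"
    using assms(2,3) by (simp add: openin_open_eq)
  then have "openin (subtopology (top_on X) (\<phi> ` UB)) (\<phi> ` W)"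
    using homeomorphic_imp_open_map[OF hom] by (simp add: open_map_def)
  with op show ?thesis by (metis openin_trans_full)
qed

lemma chart_open_preimage:
  assumes "\<phi> \<in> charts X" "openin (top_on X) C"
  shows "open {z \<in> UB. \<phi> z \<in> C}"
proof -
  have "continuous_map (top_of_set UB) (top_on X) \<phi>"
    using assms(1)
    by (auto simp: charts_def embedding_map_def continuous_map_in_subtopology
        dest!: homeomorphic_imp_continuous_map)
  from openin_continuous_map_preimage[OF this assms(2)]
  show ?thesis using openin_open_trans[of UB] by simp
qed

text \<open>What an embedding by a complete linear system provides: through the lifts
  \<open>F\<close>, the sections of the bundle are exactly the restrictions of linear forms.\<close>

locale linear_sections =
  fixes X :: "'i::finite ppt set" and g :: "'i cocycle" and F :: "'i chart \<Rightarrow> complex ^ 3 \<Rightarrow> complex ^ 'i"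
  assumes threefold: "smooth_threefold X"
    and lifts: "\<And>\<phi>. \<phi> \<in> charts X \<Longrightarrow> lifts \<phi> (F \<phi>)"
    and sections: "sections X g =
      {(\<lambda>\<phi> z. if \<phi> \<in> charts X \<and> z \<in> UB then \<Sum>i\<in>UNIV. l $ i * F \<phi> z $ i else 0) |l. True}"
begin

text \<open>The value 0 off the charts and the ball follows the normalisation in
  \<open>sections\<close>, which makes equality of sections literal equality of functions.\<close>

definition sec :: "complex ^ 'i \<Rightarrow> 'i sect" where
  "sec l = (\<lambda>\<phi> z. if \<phi> \<in> charts X \<and> z \<in> UB then lin l (F \<phi> z) else 0)"

lemma sections_eq: "sections X g = range sec"
  unfolding sections sec_def lin_def by auto

lemma sec_eq: "\<phi> \<in> charts X \<Longrightarrow> z \<in> UB \<Longrightarrow> sec l \<phi> z = lin l (F \<phi> z)"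
  by (simp add: sec_def)

lemma section_comb_sec: "section_comb (\<lambda>k. sec (l k)) c = sec (\<Sum>k\<in>UNIV. c $ k *s l k)"
  by (auto simp: section_comb_def sec_def lin_sum_left lin_scale_left fun_eq_iff)

lemma chart_value: "\<phi> \<in> charts X \<Longrightarrow> z \<in> UB \<Longrightarrow> F \<phi> z \<noteq> 0 \<and> \<phi> z = pt (F \<phi> z) \<and> \<phi> z \<in> X"
  using lifts[of \<phi>] by (auto simp: lifts_def charts_def)

lemma lift_in_cone: "\<phi> \<in> charts X \<Longrightarrow> z \<in> UB \<Longrightarrow> F \<phi> z \<in> \<Union>X"
  using chart_value[of \<phi> z] self_in_pt by (metis UnionI)

lemma point_in_chart:
  assumes "p \<in> X" obtains \<phi> z where "\<phi> \<in> charts X" "z \<in> UB" "p = \<phi> z"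
  using threefold assms unfolding smooth_threefold_def by blast

lemma cone_point:
  assumes "x \<in> \<Union>X" "x \<noteq> 0"
  obtains \<phi> z c where "\<phi> \<in> charts X" "z \<in> UB" "c \<noteq> 0" "x = c *s F \<phi> z"
proof -
  from assms(1) obtain p where p: "p \<in> X" "x \<in> p" by blast
  from point_in_chart[OF p(1)] obtain \<phi> z where z: "\<phi> \<in> charts X" "z \<in> UB" "p = \<phi> z" by blast
  with p chart_value have "x \<in> pt (F \<phi> z)" by metis
  with assms(2) obtain c where "c \<noteq> 0" "x = c *s F \<phi> z" by (metis pt_nonzero_unique)
  with z that show thesis by blast
qed

lemma topspace_X: "topspace (top_on X) = X"
  using threefold by (auto simp: smooth_threefold_def topspace_proj_topology)

text \<open>Coefficient vectors range over the whole ambient space while \<open>X\<close> may span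
  less, so different forms can give one section. Every nonzero point of the cone
  \<open>\<Union>X\<close> is a multiple of a lift, so values on the cone decide.\<close>

lemma sec_eq_iff: "sec l = sec m \<longleftrightarrow> (\<forall>x\<in>\<Union>X. lin l x = lin m x)"
proof
  assume eq: "sec l = sec m"
  show "\<forall>x\<in>\<Union>X. lin l x = lin m x"
  proof
    fix x assume x: "x \<in> \<Union>X"
    show "lin l x = lin m x"
    proof (cases "x = 0")
      case True then show ?thesis by (simp add: lin_def)
    next
      case False
      with x obtain \<phi> z c where z: "\<phi> \<in> charts X" "z \<in> UB" "x = c *s F \<phi> z"
        using cone_point by metis
      with eq sec_eq show ?thesis by (metis lin_scale_right)
    qed
  qed
next
  assume "\<forall>x\<in>\<Union>X. lin l x = lin m x"
  then show "sec l = sec m"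
    using lift_in_cone unfolding sec_def fun_eq_iff by (metis (full_types))
qed

lemma sec_zero: "sec 0 = (\<lambda>_ _. 0)"
  by (simp add: sec_def fun_eq_iff)

lemma linear_system_eq: "linear_system X g = {divisor X (sec l) |l. \<exists>x\<in>\<Union>X. lin l x \<noteq> 0}"
  unfolding linear_system_def sections_eq using sec_eq_iff[of _ 0] by (auto simp: sec_zero)

lemma sec_holo: "\<phi> \<in> charts X \<Longrightarrow> holo UB (\<lambda>z. lin l (F \<phi> z))"
  using lifts lifts_holo_lin by blast

text \<open>Irreducibility of \<open>X\<close>, tested on linear forms. The set \<open>C\<close> of
  points near which \<open>l\<close> vanishes is open; by the identity theorem a chart meeting
  \<open>C\<close> lies inside it, so \<open>C\<close> is closed as well, and connectedness leaves
  only \<open>C = {}\<close> or \<open>C = X\<close>.\<close>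

lemma linear_forms_integral:
  assumes prod: "\<And>x. x \<in> \<Union>X \<Longrightarrow> lin l x * lin m x = 0"
    and m: "\<exists>x\<in>\<Union>X. lin m x \<noteq> 0" and x: "x \<in> \<Union>X"
  shows "lin l x = 0"
proof -
  define zero where "zero \<phi> W \<longleftrightarrow> \<phi> \<in> charts X \<and> open W \<and> W \<subseteq> UB \<and> (\<forall>z\<in>W. lin l (F \<phi> z) = 0)"
    for \<phi> W
  define C where "C = \<Union>{\<phi> ` W |\<phi> W. zero \<phi> W}"
  have C_open: "openin (top_on X) C"
    unfolding C_def zero_def by (intro openin_Union) (auto intro: chart_open_image)
  have C_zero: "lin l y = 0" if "p \<in> C" "y \<in> p" for p y
  proof (cases "y = 0")
    case True then show ?thesis by (simp add: lin_def)
  next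
    case False
    from that obtain \<phi> W z where z: "zero \<phi> W" "z \<in> W" "p = \<phi> z" unfolding C_def by blast
    then have "\<phi> \<in> charts X" "z \<in> UB" "lin l (F \<phi> z) = 0" unfolding zero_def by auto
    with that(2) z(3) False chart_value show ?thesis
      by (metis pt_nonzero_unique lin_scale_right mult_zero_right)
  qed
  have spread: "\<phi> ` UB \<subseteq> C" if \<phi>: "\<phi> \<in> charts X" "z \<in> UB" "\<phi> z \<in> C" for \<phi> z
  proof -
    have "lin l (F \<phi> w) = 0" if "w \<in> UB" for w
    proof (rule holo_identity_theorem[of UB "\<lambda>z. lin l (F \<phi> z)"])
      show "open {z \<in> UB. \<phi> z \<in> C}" by (rule chart_open_preimage[OF \<phi>(1) C_open])
      show "lin l (F \<phi> v) = 0" if "v \<in> {z \<in> UB. \<phi> z \<in> C}" for v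
        using that C_zero[of "\<phi> v" "F \<phi> v"] chart_value[OF \<phi>(1)] self_in_pt[of "F \<phi> v"] by auto
    qed (use that \<phi> sec_holo in auto)
    then have "zero \<phi> UB" using \<phi> by (simp add: zero_def)
    then show ?thesis unfolding C_def by blast
  qed
  have "openin (top_on X) (X - C)"
  proof (subst openin_subopen, intro ballI)
    fix p assume p: "p \<in> X - C"
    then obtain \<phi> z where z: "\<phi> \<in> charts X" "z \<in> UB" "p = \<phi> z"
      using point_in_chart by blast
    have "\<phi> ` UB \<inter> C = {}" using spread[OF z(1)] z p by blast
    moreover have "\<phi> ` UB \<subseteq> X" using chart_value[OF z(1)] by blast
    ultimately show "\<exists>T. openin (top_on X) T \<and> p \<in> T \<and> T \<subseteq> X - C"
      using z chart_open_image[OF z(1), of UB] by (intro exI[of _ "\<phi> ` UB"]) auto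
  qed
  then have "closedin (top_on X) C"
    using openin_subset[OF C_open] unfolding closedin_def topspace_X by blast
  with C_open threefold have "C = {} \<or> C = X"
    by (metis connected_space_clopen_in smooth_threefold_def topspace_X)
  moreover have "C \<noteq> {}"
  proof -
    from m obtain y where y: "y \<in> \<Union>X" "lin m y \<noteq> 0" by blast
    then have "y \<noteq> 0" by (auto simp: lin_def)
    with y obtain \<phi> z c where z: "\<phi> \<in> charts X" "z \<in> UB" "c \<noteq> 0" "y = c *s F \<phi> z"
      using cone_point by metis
    \<comment> \<open>Where \<open>m\<close> does not vanish, the product hypothesis forces
      \<open>l\<close> to vanish; this open set puts a point into \<open>C\<close>.\<close>
    let ?W = "{z \<in> UB. lin m (F \<phi> z) \<in> - {0}}"
    have "open ?W"
      by (intro holo_open_preimage sec_holo z) auto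
    moreover have "lin l (F \<phi> w) = 0" if "w \<in> ?W" for w
      using that prod[OF lift_in_cone[OF z(1)], of w] by auto
    ultimately have "zero \<phi> ?W" using z by (auto simp: zero_def)
    moreover have "z \<in> ?W" using z y by (auto simp: lin_scale_right)
    ultimately show ?thesis unfolding C_def by blast
  qed
  ultimately show ?thesis using x C_zero by blast
qed

text \<open>A section is a local equation of its own divisor, with unit 1. Two charts are allowed
  because invariance compares a divisor on a chart and on its translate.\<close>

lemma divisor_eq_factor:
  assumes "divisor X (sec l) \<phi> = divisor X (sec m) \<psi>" "\<phi> \<in> charts X" "\<psi> \<in> charts X"
  obtains u where "holo UB u" "\<And>z. z \<in> UB \<Longrightarrow> u z \<noteq> 0"
    "\<And>z. z \<in> UB \<Longrightarrow> lin l (F \<phi> z) = u z * lin m (F \<psi> z)"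
proof -
  have "(\<lambda>z. if z \<in> UB then 1 * sec l \<phi> z else 0) \<in> divisor X (sec l) \<phi>"
    using assms(2) holo_const[of UB 1] unfolding divisor_def by auto
  with assms(1) have "(\<lambda>z. if z \<in> UB then 1 * sec l \<phi> z else 0) \<in> divisor X (sec m) \<psi>" by simp
  then obtain u where u: "holo UB u" "\<And>z. z \<in> UB \<Longrightarrow> u z \<noteq> 0"
    and eq: "(\<lambda>z. if z \<in> UB then 1 * sec l \<phi> z else 0) = (\<lambda>z. if z \<in> UB then u z * sec m \<psi> z else 0)"
    using assms(3) unfolding divisor_def by auto
  have "lin l (F \<phi> z) = u z * lin m (F \<psi> z)" if "z \<in> UB" for z
    using fun_cong[OF eq, of z] that assms(2,3) by (simp add: sec_eq)
  with u that show thesis by blast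
qed

lemma divisor_sec_eqI:
  assumes c: "holo UB c" "\<And>z. z \<in> UB \<Longrightarrow> c z \<noteq> 0"
    and eq: "\<And>z. z \<in> UB \<Longrightarrow> lin l (F \<phi> z) = c z * lin m (F \<psi> z)"
    and ch: "\<phi> \<in> charts X" "\<psi> \<in> charts X"
  shows "divisor X (sec l) \<phi> = divisor X (sec m) \<psi>"
proof -
  \<comment> \<open>Stated for arbitrary data, so that it applies a second time with the two
    sections exchanged and \<open>c\<close> inverted.\<close>
  have sub: "divisor X (sec l) \<phi> \<subseteq> divisor X (sec m) \<psi>"
    if c: "holo UB c" "\<And>z. z \<in> UB \<Longrightarrow> c z \<noteq> 0"
      and eq: "\<And>z. z \<in> UB \<Longrightarrow> lin l (F \<phi> z) = c z * lin m (F \<psi> z)"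
      and ch: "\<phi> \<in> charts X" "\<psi> \<in> charts X" for c l m \<phi> \<psi>
  proof
    fix f assume "f \<in> divisor X (sec l) \<phi>"
    then obtain u where u: "holo UB u" "\<forall>z\<in>UB. u z \<noteq> 0" "f = (\<lambda>z. if z \<in> UB then u z * sec l \<phi> z else 0)"
      using ch unfolding divisor_def by auto
    have "f = (\<lambda>z. if z \<in> UB then (u z * c z) * sec m \<psi> z else 0)"
      using u(3) eq ch by (auto simp: sec_eq fun_eq_iff)
    moreover have "holo UB (\<lambda>z. u z * c z)" by (intro holo_mult u c)
    moreover have "\<forall>z\<in>UB. u z * c z \<noteq> 0" using u c by auto
    ultimately show "f \<in> divisor X (sec m) \<psi>"
      using ch unfolding divisor_def by auto
  qed
  show ?thesis
  proof (rule equalityI)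
    show "divisor X (sec l) \<phi> \<subseteq> divisor X (sec m) \<psi>" by (rule sub[OF assms])
    show "divisor X (sec m) \<psi> \<subseteq> divisor X (sec l) \<phi>"
      using holo_inverse[OF c] c eq by (intro sub[of "\<lambda>z. inverse (c z)"] ch) auto
  qed
qed

lemma divisor_scale:
  assumes "c \<noteq> 0" shows "divisor X (sec (c *s l)) = divisor X (sec l)"
proof
  fix \<phi>
  show "divisor X (sec (c *s l)) \<phi> = divisor X (sec l) \<phi>"
  proof (cases "\<phi> \<in> charts X")
    case True
    then show ?thesis
      using assms by (intro divisor_sec_eqI[of "\<lambda>_. c"]) (auto simp: holo_const lin_scale_left)
  qed (simp add: divisor_def)
qed

text \<open>Equal divisors make the two forms differ locally by a holomorphic unit, which is locally
  bounded. Both sides scale alike along a line of the cone, so compactness of \<open>X\<close>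
  yields one bound for the whole cone.\<close>

lemma equal_divisors_bound:
  assumes "divisor X (sec l) = divisor X (sec m)"
  shows "\<exists>B. \<forall>x\<in>\<Union>X. cmod (lin l x) \<le> B * cmod (lin m x)"
proof -
  define good where "good T \<longleftrightarrow> openin (top_on X) T \<and>
      (\<exists>B. \<forall>p\<in>T. \<forall>x\<in>p. cmod (lin l x) \<le> B * cmod (lin m x))" for T
  have "\<exists>T. good T \<and> p \<in> T" if p: "p \<in> X" for p
  proof -
    obtain \<phi> z where z: "\<phi> \<in> charts X" "z \<in> UB" "p = \<phi> z"
      using point_in_chart[OF p] by blast
    from assms have "divisor X (sec l) \<phi> = divisor X (sec m) \<phi>" by simp
    from divisor_eq_factor[OF this z(1) z(1)] obtain u where
      u: "holo UB u" "\<And>z. z \<in> UB \<Longrightarrow> lin l (F \<phi> z) = u z * lin m (F \<phi> z)" by metis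
    \<comment> \<open>The summand 1 makes \<open>u z\<close> lie strictly inside the ball, so that
      \<open>?W\<close> is an open neighbourhood of \<open>z\<close>.\<close>
    let ?B = "cmod (u z) + 1"
    let ?W = "{w \<in> UB. u w \<in> ball 0 ?B}"
    have "open ?W"
      by (intro holo_open_preimage u) auto
    then have "openin (top_on X) (\<phi> ` ?W)" by (intro chart_open_image z) auto
    moreover have "cmod (lin l x) \<le> ?B * cmod (lin m x)" if w: "w \<in> ?W" "x \<in> \<phi> w" for w x
    proof (cases "x = 0")
      case False
      have "w \<in> UB" using w by simp
      with w False chart_value[OF z(1)] obtain c where "x = c *s F \<phi> w"
        by (metis pt_nonzero_unique)
      with u(2)[OF \<open>w \<in> UB\<close>] have "cmod (lin l x) = cmod (u w) * cmod (lin m x)"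
        by (simp add: lin_scale_right norm_mult)
      also have "\<dots> \<le> ?B * cmod (lin m x)"
        using w by (intro mult_right_mono) auto
      finally show ?thesis .
    qed (simp add: lin_def)
    ultimately have "good (\<phi> ` ?W)" unfolding good_def by blast
    moreover have "p \<in> \<phi> ` ?W" using z by auto
    ultimately show ?thesis by blast
  qed
  then have "X \<subseteq> \<Union>{T. good T}" by blast
  moreover have "\<forall>T\<in>{T. good T}. openin (top_on X) T" by (simp add: good_def)
  moreover have "compact_space (top_on X)" using threefold by (simp add: smooth_threefold_def)
  ultimately obtain \<F> where \<F>: "finite \<F>" "\<F> \<subseteq> {T. good T}" "X \<subseteq> \<Union>\<F>"
    unfolding compact_space_alt topspace_X by meson
  from \<F>(2) have "\<forall>T\<in>\<F>. \<exists>B. \<forall>p\<in>T. \<forall>x\<in>p. cmod (lin l x) \<le> B * cmod (lin m x)"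
    by (auto simp: good_def)
  then obtain B where B: "\<And>T p x. T \<in> \<F> \<Longrightarrow> p \<in> T \<Longrightarrow> x \<in> p \<Longrightarrow> cmod (lin l x) \<le> B T * cmod (lin m x)"
    by metis
  show ?thesis
  \<comment> \<open>The sum of absolute values dominates every local bound, whatever its
    sign.\<close>
  proof (intro exI[of _ "\<Sum>T\<in>\<F>. \<bar>B T\<bar>"] ballI)
    fix x assume "x \<in> \<Union>X"
    with \<F>(3) obtain p T where T: "T \<in> \<F>" "p \<in> T" "x \<in> p" by blast
    have "B T \<le> (\<Sum>T\<in>\<F>. \<bar>B T\<bar>)"
      using member_le_sum[of T \<F> "\<lambda>T. \<bar>B T\<bar>"] T \<F>(1) by auto
    with B[OF T] show "cmod (lin l x) \<le> (\<Sum>T\<in>\<F>. \<bar>B T\<bar>) * cmod (lin m x)"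
      by (meson mult_right_mono norm_ge_zero order_trans)
  qed
qed

end

text \<open>After the power of the variable is divided out, a polynomial without nonzero roots would
  leave a constant, hence be a monomial, contrary to the two nonzero coefficients.\<close>

lemma poly_nonzero_root:
  fixes p :: "complex poly"
  assumes "coeff p i \<noteq> 0" "coeff p j \<noteq> 0" "i \<noteq> j"
  obtains t where "t \<noteq> 0" "poly p t = 0"
proof -
  have "p \<noteq> 0" using assms by auto
  define k where "k = order 0 p"
  from order_decomp[OF \<open>p \<noteq> 0\<close>, of 0] obtain q where
    q: "p = [:0, 1:] ^ k * q" "\<not> [:0, 1:] dvd q" by (auto simp: k_def)
  have "\<exists>t. t \<noteq> 0 \<and> poly p t = 0"
  proof (rule ccontr)
    assume none: "\<not> (\<exists>t. t \<noteq> 0 \<and> poly p t = 0)"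
    have "poly q 0 \<noteq> 0" using q(2) by (simp add: dvd_iff_poly_eq_0)
    moreover have "poly q t \<noteq> 0" if "t \<noteq> 0" for t
      using none that by (auto simp: q(1))
    ultimately have "\<nexists>t. poly q t = 0" by metis
    then have "constant (poly q)" using Fundamental_Theorem_Algebra.fundamental_theorem_of_algebra by blast
    then have "degree q = 0" by (simp add: constant_degree)
    then obtain c where "q = [:c:]" by (rule degree_eq_zeroE)
    with q(1) have "p = monom c k" by (simp add: monom_altdef)
    with assms show False by (auto split: if_splits)
  qed
  with that show thesis by blast
qed

section \<open>Torus weights\<close>

definition weight :: "idx set \<Rightarrow> int" where
  "weight S = (\<Sum>j\<in>S. wt j)"

definition weight_part :: "int \<Rightarrow> ext \<Rightarrow> ext" where
  "weight_part v l = (\<chi> S. if weight S = v then l $ S else 0)"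

lemma ext_action_nth: "ext_action s x $ S = s powi weight S * x $ S"
  by (simp add: ext_action_def weight_def)

lemma ext_action_scale: "ext_action s (c *s x) = c *s ext_action s x"
  by (simp add: vec_eq_iff ext_action_nth)

lemma ext_action_mult:
  "s \<noteq> 0 \<Longrightarrow> t \<noteq> 0 \<Longrightarrow> ext_action s (ext_action t x) = ext_action (s * t) x"
  by (simp add: vec_eq_iff ext_action_nth power_int_mult_distrib)

lemma ext_action_nonzero: "s \<noteq> 0 \<Longrightarrow> x \<noteq> 0 \<Longrightarrow> ext_action s x \<noteq> 0"
  by (simp add: vec_eq_iff ext_action_nth)

lemma ext_action_pt: "ext_action s ` pt x = pt (ext_action s x)"
  by (auto simp: pt_def vec.span_singleton ext_action_scale image_iff)

lemma lin_ext_action_weight: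
  assumes "\<And>S. l $ S \<noteq> 0 \<Longrightarrow> weight S = v"
  shows "lin l (ext_action s x) = s powi v * lin l x"
  unfolding lin_def sum_distrib_left
  by (rule sum.cong) (use assms in \<open>auto simp: ext_action_nth\<close>)

lemma weight_part_nonzero:
  assumes "lin (weight_part v l) x \<noteq> 0" shows "v \<in> range weight"
proof (rule ccontr)
  assume "v \<notin> range weight"
  then have "weight_part v l = 0" by (auto simp: vec_eq_iff weight_part_def)
  with assms show False by simp
qed

text \<open>Clearing denominators in \<open>s \<mapsto> l (s \<cdot> x)\<close>, a Laurent polynomial whose coefficients are the
  values of the weight parts of \<open>l\<close>.\<close>

lemma ext_action_poly:
  obtains p :: "complex poly" and N :: int where
    "\<And>s. s \<noteq> 0 \<Longrightarrow> poly p s = s powi N * lin l (ext_action s x)"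
    "\<And>v. lin (weight_part v l) x \<noteq> 0 \<Longrightarrow> v + N \<ge> 0 \<and> coeff p (nat (v + N)) = lin (weight_part v l) x"
proof -
  \<comment> \<open>Minus the lowest weight of a coordinate, so that multiplication by
    \<open>s powi N\<close> leaves no negative exponent.\<close>
  define N where "N = Max (range (\<lambda>S. - weight S))"
  have N: "weight S + N \<ge> 0" for S
  proof -
    have "- weight S \<le> N" unfolding N_def by (rule Max_ge) auto
    then show ?thesis by simp
  qed
  define p where "p = (\<Sum>S\<in>UNIV. monom (l $ S * x $ S) (nat (weight S + N)))"
  show thesis
  proof (rule that[of p N])
    fix s :: complex assume "s \<noteq> 0"
    then have "s powi N * s powi weight S = s ^ nat (weight S + N)" for S
      using N[of S] power_int_add[of s N "weight S"] by (simp add: power_int_def add.commute)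
    then have eq: "s powi N * (l $ S * (s powi weight S * x $ S)) = l $ S * x $ S * s ^ nat (weight S + N)" for S
      by (metis mult.assoc mult.left_commute mult.commute)
    show "poly p s = s powi N * lin l (ext_action s x)"
      unfolding p_def poly_sum poly_monom lin_def ext_action_nth sum_distrib_left
      by (simp only: eq)
  next
    fix v assume v: "lin (weight_part v l) x \<noteq> 0"
    then obtain S where "weight S = v"
      using weight_part_nonzero by blast
    with N have "v + N \<ge> 0" by metis
    \<comment> \<open>Both arguments of \<open>nat\<close> are nonnegative, so distinct weights keep
      distinct exponents.\<close>
    moreover have "nat (weight T + N) = nat (v + N) \<longleftrightarrow> weight T = v" for T
      using N[of T] calculation by (auto simp: nat_eq_iff2)
    then have "coeff p (nat (v + N)) = lin (weight_part v l) x"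
      by (simp add: p_def coeff_sum lin_def weight_part_def if_distrib[of "\<lambda>t. t * _"] cong: if_cong)
    ultimately show "v + N \<ge> 0 \<and> coeff p (nat (v + N)) = lin (weight_part v l) x" by blast
  qed
qed

section \<open>The torus action on lifts, forms and divisors\<close>

locale torus_sections = linear_sections X g F
  for X :: "idx set ppt set" and g :: "idx set cocycle" and F :: "idx set chart \<Rightarrow> complex ^ 3 \<Rightarrow> ext" +
  assumes torus_Aut: "\<And>s. s \<noteq> 0 \<Longrightarrow> torus X s \<in> Aut X"
begin

lemma torus_chart: "s \<noteq> 0 \<Longrightarrow> \<phi> \<in> charts X \<Longrightarrow> torus X s \<circ> \<phi> \<in> charts X"
  using torus_Aut[of s] chart_value[of \<phi>] unfolding Aut_def by blast

lemma torus_value: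
  "\<phi> \<in> charts X \<Longrightarrow> z \<in> UB \<Longrightarrow> (torus X s \<circ> \<phi>) z = pt (ext_action s (F \<phi> z))"
  using chart_value[of \<phi> z] by (metis comp_apply torus_def restrict_apply' ext_action_pt)

lemma torus_cone:
  assumes "s \<noteq> 0" "x \<in> \<Union>X" shows "ext_action s x \<in> \<Union>X"
proof -
  from assms(2) obtain p where p: "p \<in> X" "x \<in> p" by blast
  have "torus X s p \<in> X" using torus_Aut[OF assms(1)] p(1) by (auto simp: Aut_def bij_betw_def)
  with p show ?thesis by (auto simp: torus_def)
qed

text \<open>The lifts \<open>F\<close> are chosen chart by chart and need not be equivariant. On the
  translated chart both vectors represent the same point, so \<open>proportional_lifts\<close>
  supplies the unit relating them.\<close>

lemma torus_lift:
  assumes s: "s \<noteq> 0" and \<phi>: "\<phi> \<in> charts X"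
  obtains c where "holo UB c" "\<And>z. z \<in> UB \<Longrightarrow> c z \<noteq> 0"
    "\<And>z. z \<in> UB \<Longrightarrow> F (torus X s \<circ> \<phi>) z = c z *s ext_action s (F \<phi> z)"
proof (rule proportional_lifts[of "\<lambda>z. ext_action s (F \<phi> z)" "F (torus X s \<circ> \<phi>)"])
  note t = torus_chart[OF assms]
  show "holo UB (\<lambda>z. ext_action s (F \<phi> z) $ i)" for i
    using lifts[OF \<phi>] by (auto simp: lifts_def ext_action_nth intro!: holo_mult holo_const)
  show "holo UB (\<lambda>z. F (torus X s \<circ> \<phi>) z $ i)" for i
    using lifts[OF t] by (auto simp: lifts_def)
  show "\<exists>c. c \<noteq> 0 \<and> F (torus X s \<circ> \<phi>) z = c *s ext_action s (F \<phi> z)" if "z \<in> UB" for z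
    using chart_value[OF t that] torus_value[OF \<phi> that, of s] self_in_pt pt_nonzero_unique by metis
  show "ext_action s (F \<phi> z) \<noteq> 0" if "z \<in> UB" for z
    using chart_value[OF \<phi> that] ext_action_nonzero s by blast
qed (use that in blast)

text \<open>Passing to the translated chart multiplies the equation by
  \<open>c z * s powi v\<close>, which is holomorphic without zeros.\<close>

lemma weight_vector_invariant:
  assumes "\<And>S. l $ S \<noteq> 0 \<Longrightarrow> weight S = v"
  shows "invariant_divisor X (torus X) (divisor X (sec l))"
  unfolding invariant_divisor_def
proof (intro allI impI ballI)
  fix s :: complex and \<phi> assume s: "s \<noteq> 0" and \<phi>: "\<phi> \<in> charts X"
  from torus_lift[OF this] obtain c where c: "holo UB c" "\<And>z. z \<in> UB \<Longrightarrow> c z \<noteq> 0"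
    "\<And>z. z \<in> UB \<Longrightarrow> F (torus X s \<circ> \<phi>) z = c z *s ext_action s (F \<phi> z)" by blast
  show "divisor X (sec l) (torus X s \<circ> \<phi>) = divisor X (sec l) \<phi>"
  proof (rule divisor_sec_eqI[of "\<lambda>z. c z * s powi v"])
    show "holo UB (\<lambda>z. c z * s powi v)" by (intro holo_mult holo_const c)
  qed (use s c \<phi> torus_chart in \<open>auto simp: lin_scale_right lin_ext_action_weight[OF assms]\<close>)
qed

text \<open>Invariance makes the equation on the translated chart a multiple of the original one at
  the same parameter \<open>z\<close>, so zeros are carried along the orbit.\<close>

lemma invariant_zero:
  assumes inv: "invariant_divisor X (torus X) (divisor X (sec l))"
    and s: "s \<noteq> 0" and x: "x \<in> \<Union>X" "lin l x = 0"
  shows "lin l (ext_action s x) = 0"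
proof (cases "x = 0")
  case True then show ?thesis by (simp add: lin_def ext_action_nth)
next
  case False
  with x obtain \<phi> z a where z: "\<phi> \<in> charts X" "z \<in> UB" "a \<noteq> 0" "x = a *s F \<phi> z"
    using cone_point by metis
  from torus_lift[OF s z(1)] obtain c where
    c: "c z \<noteq> 0" "F (torus X s \<circ> \<phi>) z = c z *s ext_action s (F \<phi> z)"
    using z(2) by metis
  have "divisor X (sec l) (torus X s \<circ> \<phi>) = divisor X (sec l) \<phi>"
    using inv s z(1) by (auto simp: invariant_divisor_def)
  from divisor_eq_factor[OF this torus_chart[OF s z(1)] z(1)] obtain u where
    "lin l (F (torus X s \<circ> \<phi>) z) = u z * lin l (F \<phi> z)" using z(2) by metis
  with x z c show ?thesis
    by (simp add: lin_scale_right ext_action_scale)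
qed

text \<open>Two nonzero weight parts at \<open>x\<close> give the polynomial of the orbit two
  nonzero coefficients, hence a nonzero root. Invariance spreads this zero over the orbit, which is
  too many roots.\<close>

lemma invariant_weight_parts_product:
  assumes inv: "invariant_divisor X (torus X) (divisor X (sec l))"
    and vw: "v \<noteq> w" and x: "x \<in> \<Union>X"
  shows "lin (weight_part v l) x * lin (weight_part w l) x = 0"
proof (rule ccontr)
  assume nz: "lin (weight_part v l) x * lin (weight_part w l) x \<noteq> 0"
  obtain p :: "complex poly" and N :: int where
    p: "\<And>s. s \<noteq> 0 \<Longrightarrow> poly p s = s powi N * lin l (ext_action s x)" and
    cf: "\<And>v. lin (weight_part v l) x \<noteq> 0 \<Longrightarrow> v + N \<ge> 0 \<and> coeff p (nat (v + N)) = lin (weight_part v l) x"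
    using ext_action_poly by metis
  have c: "coeff p (nat (v + N)) \<noteq> 0" "coeff p (nat (w + N)) \<noteq> 0" "nat (v + N) \<noteq> nat (w + N)"
    using cf[of v] cf[of w] nz vw by auto
  then obtain t where t: "t \<noteq> 0" "poly p t = 0" by (rule poly_nonzero_root)
  then have t0: "lin l (ext_action t x) = 0" using p by auto
  \<comment> \<open>The point at parameter \<open>s\<close> is reached from the zero at
    \<open>t\<close> by acting with \<open>s / t\<close>.\<close>
  have "poly p s = 0" if "s \<noteq> 0" for s
  proof -
    have "lin l (ext_action (s / t) (ext_action t x)) = 0"
      using invariant_zero[OF inv _ torus_cone[OF t(1) x] t0] that t(1) by simp
    then show ?thesis using p[OF that] that t(1) by (simp add: ext_action_mult)
  qed
  then have "- {0} \<subseteq> {s. poly p s = 0}" by auto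
  moreover have "p \<noteq> 0" using c by auto
  ultimately have "finite (- {0 :: complex})"
    using poly_roots_finite finite_subset by blast
  then show False by (simp add: infinite_UNIV_char_0)
qed

text \<open>If one weight part is nonzero somewhere on the cone, irreducibility makes all others
  vanish on it. They vanish on the cone only, so the conclusion equates sections and not
  forms.\<close>

lemma invariant_imp_weight_vector:
  assumes "invariant_divisor X (torus X) (divisor X (sec l))"
  obtains v where "sec l = sec (weight_part v l)"
proof (cases "\<exists>v. \<exists>x\<in>\<Union>X. lin (weight_part v l) x \<noteq> 0")
  case True
  then obtain v where v: "\<exists>x\<in>\<Union>X. lin (weight_part v l) x \<noteq> 0" by blast
  have zero: "lin (weight_part w l) x = 0" if "w \<noteq> v" "x \<in> \<Union>X" for w x
    using linear_forms_integral[of "weight_part w l" "weight_part v l"]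
      invariant_weight_parts_product[OF assms that(1)] v that(2) by blast
  have "l = (\<Sum>w\<in>range weight. weight_part w l)"
    by (simp add: vec_eq_iff weight_part_def)
  then have "lin l x = (\<Sum>w\<in>range weight. lin (weight_part w l) x)" for x
    by (subst lin_sum_left[symmetric]) (rule arg_cong[of _ _ "\<lambda>l. lin l x"])
  moreover have "(\<Sum>w\<in>range weight. lin (weight_part w l) x) =
      (\<Sum>w\<in>range weight. if w = v then lin (weight_part v l) x else 0)" if "x \<in> \<Union>X" for x
    by (rule sum.cong) (use zero that in auto)
  moreover have "v \<in> range weight"
    using v weight_part_nonzero by blast
  ultimately have "lin l x = lin (weight_part v l) x" if "x \<in> \<Union>X" for x
    using that by simp
  then show thesis by (intro that[of v]) (simp add: sec_eq_iff)
next
  \<comment> \<open>All weight parts vanish on the cone, so both sections are zero and the weight 0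
    is an arbitrary choice.\<close>
  case False
  have "l = (\<Sum>w\<in>range weight. weight_part w l)"
    by (simp add: vec_eq_iff weight_part_def)
  then have "lin l x = (\<Sum>w\<in>range weight. lin (weight_part w l) x)" for x
    by (subst lin_sum_left[symmetric]) (rule arg_cong[of _ _ "\<lambda>l. lin l x"])
  with False show thesis by (intro that[of 0]) (simp add: sec_eq_iff)
qed

text \<open>Equal divisors would bound \<open>l\<close> by a multiple of \<open>m\<close>; on the
  orbit of \<open>x\<close> this bounds the nonzero power \<open>v - w\<close> of every positive
  parameter by a constant.\<close>

lemma different_weights_different_divisors:
  assumes l: "\<And>S. l $ S \<noteq> 0 \<Longrightarrow> weight S = v" and m: "\<And>S. m $ S \<noteq> 0 \<Longrightarrow> weight S = w"
    and vw: "v \<noteq> w" and x: "x \<in> \<Union>X" "lin l x \<noteq> 0"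
  shows "divisor X (sec l) \<noteq> divisor X (sec m)"
proof
  assume "divisor X (sec l) = divisor X (sec m)"
  then obtain B where B: "\<And>x. x \<in> \<Union>X \<Longrightarrow> cmod (lin l x) \<le> B * cmod (lin m x)"
    using equal_divisors_bound by blast
  have lw: "lin l (ext_action s x) = s powi v * lin l x" for s
    by (rule lin_ext_action_weight) (rule l)
  have mw: "lin m (ext_action s x) = s powi w * lin m x" for s
    by (rule lin_ext_action_weight) (rule m)
  define C where "C = B * cmod (lin m x) / cmod (lin l x)"
  have bd: "t powi (v - w) \<le> C" if t: "t > 0" for t :: real
  proof -
    let ?s = "complex_of_real t"
    have "?s \<noteq> 0" using t by simp
    from B[OF torus_cone[OF this x(1)]]
    have "t powi v * cmod (lin l x) \<le> B * (t powi w * cmod (lin m x))"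
      using t unfolding lw mw norm_mult norm_power_int by simp
    then have "t powi v / t powi w * cmod (lin l x) \<le> B * cmod (lin m x)"
      using t by (simp add: pos_divide_le_eq mult.commute mult.left_commute)
    then show ?thesis
      using t x(2) by (simp add: C_def pos_le_divide_eq power_int_diff)
  qed
  \<comment> \<open>It exceeds the bound, and being at least 1 it does not decrease under positive
    powers; for a negative exponent its inverse serves as parameter.\<close>
  define r :: real where "r = 1 + \<bar>C\<bar>"
  have r: "r \<ge> 1" "r > C" unfolding r_def by auto
  have "\<exists>t>0. r \<le> t powi (v - w)"
  proof (cases "v > w")
    case True
    then have "1 \<le> v - w" by simp
    from power_int_increasing[OF this r(1)] have "r \<le> r powi (v - w)" by simp
    moreover have "r > 0" using r(1) by simp
    ultimately show ?thesis by blast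
  next
    case False
    with vw have "1 \<le> w - v" by simp
    from power_int_increasing[OF this r(1)] have "r \<le> r powi (w - v)" by simp
    also have "\<dots> = inverse r powi (v - w)"
      using power_int_minus[of r "v - w"] by (simp add: power_int_inverse)
    finally have "r \<le> inverse r powi (v - w)" .
    moreover have "inverse r > 0" using r(1) by simp
    ultimately show ?thesis by blast
  qed
  then obtain t where "t > 0" "r \<le> t powi (v - w)" by blast
  with bd[of t] r(2) show False by linarith
qed

end

section \<open>The linear span of the models\<close>

lemma wt_idx [simp]: "- 3 \<le> k \<Longrightarrow> k \<le> 3 \<Longrightarrow> wt (idx k) = k"
  by (simp add: idx_inverse)

lemma idx_eq_iff [simp]:
  "- 3 \<le> j \<Longrightarrow> j \<le> 3 \<Longrightarrow> - 3 \<le> k \<Longrightarrow> k \<le> 3 \<Longrightarrow> idx j = idx k \<longleftrightarrow> j = k"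
  by (simp add: idx_inject)

lemma UNIV_idx: "UNIV = {idx (- 3), idx (- 2), idx (- 1), idx 0, idx 1, idx 2, idx 3}"
proof -
  have "{- 3..3} = {- 3, - 2, - 1, 0, 1, 2, 3 :: int}" by auto
  moreover have "(UNIV :: idx set) = idx ` {- 3..3}"
    by (metis UNIV_eq_I wt wt_inverse imageI)
  ultimately show ?thesis by simp
qed

lemma all_idx: "(\<forall>m. P m) \<longleftrightarrow> P (idx (- 3)) \<and> P (idx (- 2)) \<and> P (idx (- 1)) \<and> P (idx 0) \<and>
    P (idx 1) \<and> P (idx 2) \<and> P (idx 3)"
proof -
  have "(\<forall>m. P m) \<longleftrightarrow> (\<forall>m\<in>UNIV. P m)" by simp
  then show ?thesis unfolding UNIV_idx by simp
qed

abbreviation quad :: "int \<Rightarrow> int \<Rightarrow> int \<Rightarrow> int \<Rightarrow> idx set" where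
  "quad a b c d \<equiv> {idx a, idx b, idx c, idx d}"

lemma wedge_add_right: "x \<and>\<^sub>W (y + z) = x \<and>\<^sub>W y + x \<and>\<^sub>W z"
  by (simp add: wedge_def vec_eq_iff algebra_simps sum.distrib)

lemma wedge_scale_right: "x \<and>\<^sub>W (c *s y) = c *s (x \<and>\<^sub>W y)"
  by (simp add: wedge_def vec_eq_iff sum_distrib_left algebra_simps)

lemma wedge_zero_right: "x \<and>\<^sub>W 0 = 0"
  by (simp add: wedge_def vec_eq_iff)

lemma wedge_add_left: "(x + y) \<and>\<^sub>W z = x \<and>\<^sub>W z + y \<and>\<^sub>W z"
  by (simp add: wedge_def vec_eq_iff algebra_simps sum.distrib)

lemma wedge_scale_left: "(c *s x) \<and>\<^sub>W y = c *s (x \<and>\<^sub>W y)"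
  by (simp add: wedge_def vec_eq_iff sum_distrib_left algebra_simps)

lemma wedge_zero_left: "0 \<and>\<^sub>W x = 0"
  by (simp add: wedge_def vec_eq_iff)

lemma wedge_axis_nth:
  "(x \<and>\<^sub>W axis B 1) $ S = (if B \<subseteq> S then shuffle_sign (S - B) B * x $ (S - B) else 0)"
proof -
  have eq: "S - A = B \<longleftrightarrow> B \<subseteq> S \<and> A = S - B" if "A \<in> Pow S" for A
    using that by blast
  have "(x \<and>\<^sub>W axis B 1) $ S =
      (\<Sum>A\<in>Pow S. if A = S - B then (if B \<subseteq> S then shuffle_sign (S - B) B * x $ (S - B) else 0) else 0)"
    unfolding wedge_def vec_lambda_beta by (rule sum.cong) (auto simp: axis_def eq double_diff)
  also have "\<dots> = (if B \<subseteq> S then shuffle_sign (S - B) B * x $ (S - B) else 0)"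
    by (subst sum.delta) auto
  finally show ?thesis .
qed

text \<open>Replaces the count of inversions by a product over \<open>A\<close>, which can be
  evaluated factor by factor on explicit sets.\<close>

lemma shuffle_sign_pair:
  assumes "i \<noteq> j"
  shows "shuffle_sign A {i, j} =
    (\<Prod>a\<in>A. (if wt i < wt a then - 1 else 1) * (if wt j < wt a then - 1 else 1))"
proof -
  have "{(a, b). a \<in> A \<and> b \<in> {i, j} \<and> wt b < wt a} =
      (\<lambda>a. (a, i)) ` {a \<in> A. wt i < wt a} \<union> (\<lambda>a. (a, j)) ` {a \<in> A. wt j < wt a}"
    by auto
  then have "card {(a, b). a \<in> A \<and> b \<in> {i, j} \<and> wt b < wt a} =
      card {a \<in> A. wt i < wt a} + card {a \<in> A. wt j < wt a}"
    using assms by (simp add: card_Un_disjoint card_image inj_on_def disjoint_iff image_iff)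
  moreover have "(- 1 :: complex) ^ card {a \<in> A. wt i < wt a} = (\<Prod>a\<in>A. if wt i < wt a then - 1 else 1)" for i
    by (simp add: prod.If_cases Int_def)
  ultimately show ?thesis
    by (simp add: shuffle_sign_def power_add prod.distrib)
qed

lemma wedge_e_e:
  assumes "- 3 \<le> a" "a < b" "b \<le> 3"
  shows "e a \<and>\<^sub>W e b = axis {idx a, idx b} 1"
proof -
  have "shuffle_sign {idx a} {idx b} = 1"
    using assms by (simp add: shuffle_sign_def cong: conj_cong)
  moreover have ab: "idx a \<noteq> idx b" using assms by simp
  moreover have "(e a \<and>\<^sub>W e b) $ S = 0" if S: "S \<noteq> {idx a, idx b}" for S
  proof -
    have "\<not> ({idx b} \<subseteq> S \<and> S - {idx b} = {idx a})" using S ab by auto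
    then show ?thesis unfolding e_def wedge_axis_nth by (auto simp: axis_def)
  qed
  moreover have "(e a \<and>\<^sub>W e b) $ {idx a, idx b} = 1"
    using calculation(1) ab by (simp add: e_def wedge_axis_nth insert_Diff_if)
  ultimately show ?thesis by (simp add: vec_eq_iff axis_def)
qed

section \<open>The annihilator of the net as a system of linear equations\<close>

lemma annihilated_iff_generators:
  "x \<in> annihilated \<tau> \<longleftrightarrow> x \<in> grade 4 \<and>
     x \<and>\<^sub>W (e 0 \<and>\<^sub>W e 1 + e (-1) \<and>\<^sub>W e 2 + e (-2) \<and>\<^sub>W e 3) = 0 \<and>
     x \<and>\<^sub>W (e (-1) \<and>\<^sub>W e 1 + e (-2) \<and>\<^sub>W e 2 + \<tau> *s (e (-3) \<and>\<^sub>W e 3)) = 0 \<and>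
     x \<and>\<^sub>W (e (-1) \<and>\<^sub>W e 0 + e (-2) \<and>\<^sub>W e 1 + e (-3) \<and>\<^sub>W e 2) = 0"
proof -
  have sub: "vec.subspace {\<omega>. x \<and>\<^sub>W \<omega> = 0}"
    by (rule vec.subspaceI) (auto simp: wedge_add_right wedge_scale_right wedge_zero_right)
  have "(\<forall>\<omega>\<in>vec.span G. x \<and>\<^sub>W \<omega> = 0) \<longleftrightarrow> (\<forall>\<omega>\<in>G. x \<and>\<^sub>W \<omega> = 0)" for G
    using vec.span_minimal[OF _ sub, of G] vec.span_superset[of G] by blast
  then show ?thesis
    unfolding annihilated_def net_def by simp
qed

lemma annihilated_subspace: "vec.subspace (annihilated \<tau>)"
  by (rule vec.subspaceI)
    (auto simp: annihilated_def grade_def wedge_add_left wedge_scale_left wedge_zero_left)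

text \<open>The product has degree 4 + 2, so the other degrees impose no equations.\<close>

lemma wedge_pair_nth:
  assumes "x \<in> grade 4" "i \<noteq> j" "card S \<noteq> 6"
  shows "(x \<and>\<^sub>W axis {i, j} 1) $ S = 0"
proof (cases "{i, j} \<subseteq> S")
  case True
  moreover have "card {i, j} = 2" using assms(2) by simp
  ultimately have "card (S - {i, j}) = card S - 2"
    using card_Diff_subset[of "{i, j}" S] by simp
  then have "card (S - {i, j}) \<noteq> 4" using assms(3) by simp
  then show ?thesis using assms(1) by (simp add: wedge_axis_nth grade_def)
qed (simp add: wedge_axis_nth del: insert_subset)

text \<open>Such a set omits one of seven indices; each generator of the net therefore gives seven
  equations.\<close>

lemma card_6_idx: "card (S :: idx set) = 6 \<longleftrightarrow> (\<exists>m. S = - {m})"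
proof -
  have "card (UNIV :: idx set) = 7" unfolding UNIV_idx by simp
  then have c: "card (- S) = 7 - card S" "card S \<le> 7" for S :: "idx set"
    using card_Diff_subset[of S UNIV] card_mono[of UNIV S] by (simp_all add: Compl_eq_Diff_UNIV)
  have "card S = 6 \<longleftrightarrow> card (- S) = 1" using c[of S] by auto
  also have "\<dots> \<longleftrightarrow> (\<exists>m. - S = {m})" by (simp add: card_1_singleton_iff)
  also have "\<dots> \<longleftrightarrow> (\<exists>m. S = - {m})" by (metis double_complement)
  finally show ?thesis .
qed

text \<open>One shape for all three generators: the scalar \<open>c\<close> is \<open>\<tau>\<close>
  for the middle one and 1 for the other two.\<close>

lemma wedge_eq_0_iff:
  assumes x: "x \<in> grade 4" and ij: "i \<noteq> j" "k \<noteq> l" "m \<noteq> n"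
  shows "x \<and>\<^sub>W (axis {i, j} 1 + axis {k, l} 1 + c *s axis {m, n} 1) = 0 \<longleftrightarrow>
    (\<forall>p. (x \<and>\<^sub>W axis {i, j} 1) $ (- {p}) + (x \<and>\<^sub>W axis {k, l} 1) $ (- {p}) +
         c * (x \<and>\<^sub>W axis {m, n} 1) $ (- {p}) = 0)"
    (is "?w = 0 \<longleftrightarrow> ?R")
proof -
  have nth: "?w $ S = (x \<and>\<^sub>W axis {i, j} 1) $ S + (x \<and>\<^sub>W axis {k, l} 1) $ S + c * (x \<and>\<^sub>W axis {m, n} 1) $ S" for S
    by (simp add: wedge_add_right wedge_scale_right)
  have "?w = 0 \<longleftrightarrow> (\<forall>S. card S = 6 \<longrightarrow> ?w $ S = 0)"
    using wedge_pair_nth[OF x] ij unfolding vec_eq_iff nth by (metis add_0 mult_zero_right zero_index)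
  then show ?thesis unfolding card_6_idx nth by blast
qed

lemma Compl_idx: "- {m} = {idx (- 3), idx (- 2), idx (- 1), idx 0, idx 1, idx 2, idx 3} - {m}"
  unfolding UNIV_idx[symmetric] by blast

text \<open>The 21 equations are listed by increasing weight, from -4 to 4. The generators are
  homogeneous, so no equation mixes weights.\<close>

lemma annihilated_iff_equations:
  "x \<in> annihilated \<tau> \<longleftrightarrow> x \<in> grade 4 \<and>
     x $ quad (- 3) (- 2) (- 1) 2 + x $ quad (- 3) (- 2) 0 1 = 0 \<and>
     x $ quad (- 3) (- 2) (- 1) 3 - x $ quad (- 3) (- 1) 0 1 = 0 \<and>
     - x $ quad (- 3) (- 2) 0 2 - x $ quad (- 3) (- 1) 0 1 = 0 \<and>
     - x $ quad (- 3) (- 2) 0 3 + \<tau> * x $ quad (- 2) (- 1) 0 1 = 0 \<and>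
     - x $ quad (- 3) (- 2) 0 3 - x $ quad (- 3) (- 1) 0 2 = 0 \<and>
     x $ quad (- 3) (- 2) 1 2 + x $ quad (- 3) (- 1) 0 2 + x $ quad (- 2) (- 1) 0 1 = 0 \<and>
     x $ quad (- 3) (- 1) 0 3 + \<tau> * x $ quad (- 2) (- 1) 0 2 = 0 \<and>
     x $ quad (- 3) (- 2) 1 3 + x $ quad (- 3) (- 1) 0 3 = 0 \<and>
     - x $ quad (- 3) (- 2) 1 3 - x $ quad (- 3) (- 1) 1 2 = 0 \<and>
     x $ quad (- 3) (- 2) 2 3 - x $ quad (- 3) 0 1 2 = 0 \<and>
     x $ quad (- 3) (- 2) 2 3 + x $ quad (- 3) (- 1) 1 3 + \<tau> * x $ quad (- 2) (- 1) 1 2 = 0 \<and>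
     x $ quad (- 3) (- 2) 2 3 - x $ quad (- 2) (- 1) 0 3 = 0 \<and>
     x $ quad (- 3) 0 1 3 + \<tau> * x $ quad (- 2) 0 1 2 = 0 \<and>
     x $ quad (- 3) (- 1) 2 3 + x $ quad (- 3) 0 1 3 = 0 \<and>
     - x $ quad (- 3) (- 1) 2 3 - x $ quad (- 2) (- 1) 1 3 = 0 \<and>
     - x $ quad (- 3) 0 2 3 + \<tau> * x $ quad (- 1) 0 1 2 = 0 \<and>
     - x $ quad (- 3) 0 2 3 - x $ quad (- 2) 0 1 3 = 0 \<and>
     x $ quad (- 2) (- 1) 2 3 + x $ quad (- 2) 0 1 3 + x $ quad (- 1) 0 1 2 = 0 \<and>
     - x $ quad (- 2) 0 2 3 - x $ quad (- 1) 0 1 3 = 0 \<and>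
     x $ quad (- 3) 1 2 3 - x $ quad (- 1) 0 1 3 = 0 \<and>
     x $ quad (- 2) 1 2 3 + x $ quad (- 1) 0 2 3 = 0"
proof (cases "x \<in> grade 4")
  case True
  have one: "axis {idx a, idx b} 1 = 1 *s axis {idx a, idx b} (1 :: complex)" for a b by simp
  show ?thesis
    unfolding annihilated_iff_generators
    apply (simp only: wedge_e_e[of 0 1, simplified] wedge_e_e[of "- 1" 2, simplified]
      wedge_e_e[of "- 2" 3, simplified] wedge_e_e[of "- 1" 1, simplified] wedge_e_e[of "- 2" 2, simplified]
      wedge_e_e[of "- 3" 3, simplified] wedge_e_e[of "- 1" 0, simplified] wedge_e_e[of "- 2" 1, simplified]
      wedge_e_e[of "- 3" 2, simplified] True simp_thms)
    \<comment> \<open>Gives the last summands of the first and third generators the coefficient 1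
      that \<open>wedge_eq_0_iff\<close> expects.\<close>
    apply (subst (1) one[of "- 2" 3], subst (1) one[of "- 3" 2])
    apply (subst wedge_eq_0_iff[OF True], simp, simp, simp)+
    apply (simp add: all_idx Compl_idx wedge_axis_nth insert_Diff_if shuffle_sign_pair)
    apply (auto simp: algebra_simps)
    done
qed (simp add: annihilated_def)

text \<open>In each weight, the equations express all coordinates by those listed here: one for each
  nonzero weight, and two for weight zero, whatever the value of \<open>\<tau>\<close>.\<close>

definition free_sets :: "idx set list" where
  "free_sets =
   [quad (- 3) (- 2) (- 1) 0,
    quad (- 3) (- 2) (- 1) 1,
    quad (- 3) (- 2) (- 1) 2,
    quad (- 3) (- 1) 0 1,
    quad (- 2) (- 1) 0 1,
    quad (- 2) (- 1) 0 2,
    quad (- 3) (- 2) 2 3,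
    quad (- 2) (- 1) 1 2,
    quad (- 2) 0 1 2,
    quad (- 1) 0 1 2,
    quad (- 1) 0 1 3,
    quad (- 1) 0 2 3,
    quad (- 1) 1 2 3,
    quad 0 1 2 3]"

text \<open>A numerical encoding of subsets, by which distinct explicit sets are told apart through their
  numerals.\<close>

definition code :: "idx set \<Rightarrow> nat" where
  "code S = (\<Sum>j\<in>S. 2 ^ nat (wt j + 3))"

section \<open>Solutions of the equations with given free coordinates\<close>

lemma distinct_free_sets: "distinct free_sets"
proof -
  have "distinct (map code free_sets)" by (simp add: free_sets_def code_def)
  then show ?thesis by (simp add: distinct_map)
qed

text \<open>Applied once for each index, it replaces a statement about all subsets by its 128
  instances.\<close>

lemma all_subsets_insert:
  "(\<forall>S. S \<subseteq> insert a A \<longrightarrow> P S) \<longleftrightarrow> (\<forall>S. S \<subseteq> A \<longrightarrow> P S \<and> P (insert a S))"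
  by (metis Diff_insert_absorb insert_Diff insert_mono subset_insert subset_insert_iff subset_insertI2)

text \<open>The equations express the other 21 coordinates of four-element sets through the 14 free
  ones.\<close>

lemma annihilated_determined:
  assumes x: "x \<in> annihilated \<tau>" and free: "\<And>S. S \<in> set free_sets \<Longrightarrow> x $ S = 0"
  shows "x = 0"
proof -
  have z: "\<forall>S\<in>set free_sets. x $ S = 0" using free by blast
  have "\<forall>S. S \<subseteq> {idx (- 3), idx (- 2), idx (- 1), idx 0, idx 1, idx 2, idx 3} \<longrightarrow> card S = 4 \<longrightarrow> x $ S = 0"
    using z x unfolding annihilated_iff_equations free_sets_def all_subsets_insert
    by (simp cong: conj_cong)
  then have "x $ S = 0" if "card S = 4" for S
    using that unfolding UNIV_idx[symmetric] by blast
  moreover have "x \<in> grade 4" using x by (simp add: annihilated_def)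
  ultimately show ?thesis by (auto simp: vec_eq_iff grade_def)
qed

lemma annihilated_extend:
  "\<exists>x\<in>annihilated \<tau>. \<forall>S\<in>set free_sets. x $ S = f S"
proof -
  \<comment> \<open>Coordinates outside the free sets are the solved equations. Codes are binary,
    the index of weight \<open>j\<close> contributing 2 to the power \<open>j + 3\<close>; the 35
    codes listed are those of the four-element sets.\<close>
  define x :: ext where "x = (\<chi> S. if card S \<noteq> 4 then 0 else
      if code S = 15 then f (quad (- 3) (- 2) (- 1) 0) else
      if code S = 23 then f (quad (- 3) (- 2) (- 1) 1) else
      if code S = 27 then - f (quad (- 3) (- 2) (- 1) 2) else
      if code S = 29 then f (quad (- 3) (- 1) 0 1) else
      if code S = 30 then f (quad (- 2) (- 1) 0 1) else
      if code S = 39 then f (quad (- 3) (- 2) (- 1) 2) else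
      if code S = 43 then - f (quad (- 3) (- 1) 0 1) else
      if code S = 45 then - (\<tau> * f (quad (- 2) (- 1) 0 1)) else
      if code S = 46 then f (quad (- 2) (- 1) 0 2) else
      if code S = 51 then (\<tau> - 1) * f (quad (- 2) (- 1) 0 1) else
      if code S = 53 then - (\<tau> * f (quad (- 2) (- 1) 0 2)) else
      if code S = 54 then f (quad (- 2) (- 1) 1 2) else
      if code S = 57 then f (quad (- 3) (- 2) 2 3) else
      if code S = 58 then f (quad (- 2) 0 1 2) else
      if code S = 60 then f (quad (- 1) 0 1 2) else
      if code S = 71 then f (quad (- 3) (- 1) 0 1) else
      if code S = 75 then \<tau> * f (quad (- 2) (- 1) 0 1) else
      if code S = 77 then - (\<tau> * f (quad (- 2) (- 1) 0 2)) else
      if code S = 78 then f (quad (- 3) (- 2) 2 3) else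
      if code S = 83 then \<tau> * f (quad (- 2) (- 1) 0 2) else
      if code S = 85 then - f (quad (- 3) (- 2) 2 3) - \<tau> * f (quad (- 2) (- 1) 1 2) else
      if code S = 86 then - (\<tau> * f (quad (- 2) 0 1 2)) else
      if code S = 89 then - (\<tau> * f (quad (- 2) 0 1 2)) else
      if code S = 90 then - (\<tau> * f (quad (- 1) 0 1 2)) else
      if code S = 92 then f (quad (- 1) 0 1 3) else
      if code S = 99 then f (quad (- 3) (- 2) 2 3) else
      if code S = 101 then \<tau> * f (quad (- 2) 0 1 2) else
      if code S = 102 then (\<tau> - 1) * f (quad (- 1) 0 1 2) else
      if code S = 105 then \<tau> * f (quad (- 1) 0 1 2) else
      if code S = 106 then - f (quad (- 1) 0 1 3) else
      if code S = 108 then f (quad (- 1) 0 2 3) else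
      if code S = 113 then f (quad (- 1) 0 1 3) else
      if code S = 114 then - f (quad (- 1) 0 2 3) else
      if code S = 116 then f (quad (- 1) 1 2 3) else
      if code S = 120 then f (quad 0 1 2 3) else 0)"
  have "x \<in> grade 4" by (simp add: x_def grade_def)
  then have "x \<in> annihilated \<tau>"
    unfolding annihilated_iff_equations by (simp add: x_def code_def algebra_simps)
  moreover have "\<forall>S\<in>set free_sets. x $ S = f S"
    by (simp add: free_sets_def x_def code_def)
  ultimately show ?thesis by blast
qed

lemma weight_zero_free_sets:
  "{S \<in> set free_sets. weight S = 0} = {quad (- 3) (- 2) 2 3, quad (- 2) (- 1) 1 2}"
  by (auto simp: free_sets_def weight_def)

lemma inj_on_weight: "inj_on weight {S \<in> set free_sets. weight S \<noteq> 0}"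
proof -
  have "distinct (map weight (filter (\<lambda>S. weight S \<noteq> 0) free_sets))"
    by (simp add: free_sets_def weight_def)
  then show ?thesis by (simp add: distinct_map)
qed

section \<open>The invariant anticanonical divisors\<close>

locale Va_sections = torus_sections V g F
  for V :: "idx set ppt set" and g :: "idx set cocycle" and F :: "idx set chart \<Rightarrow> complex ^ 3 \<Rightarrow> ext" +
  fixes \<tau> :: complex
  assumes span_V: "vec.span (\<Union>V) = annihilated \<tau>"
begin

definition coord :: "idx set \<Rightarrow> idx set sect" where
  "coord S = sec (axis S 1)"

text \<open>Equality of two forms on the cone passes to its linear span, which is explicitly
  known.\<close>

lemma sec_eq_iff_annihilated: "sec l = sec m \<longleftrightarrow> (\<forall>x\<in>annihilated \<tau>. lin l x = lin m x)"
proof -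
  have "vec.subspace {x. lin l x = lin m x}"
    by (rule vec.subspaceI) (auto simp: lin_add_right lin_scale_right, simp_all add: lin_def)
  then have "\<Union>V \<subseteq> {x. lin l x = lin m x} \<Longrightarrow> vec.span (\<Union>V) \<subseteq> {x. lin l x = lin m x}"
    by (rule vec.span_minimal[rotated])
  moreover have "\<Union>V \<subseteq> annihilated \<tau>" using vec.span_superset[of "\<Union>V"] span_V by simp
  ultimately show ?thesis unfolding sec_eq_iff span_V by blast
qed

text \<open>With \<open>u\<close> dual to the free coordinates, a vector minus its expansion in
  \<open>u\<close> has no free coordinate left and is zero; so \<open>l\<close> is determined by its
  values on \<open>u\<close>.\<close>

lemma sec_free_coordinates:
  obtains c where "sec l = sec (\<Sum>S\<in>set free_sets. c S *s axis S 1)"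
proof -
  have "\<exists>x\<in>annihilated \<tau>. \<forall>T\<in>set free_sets. x $ T = (if T = S then 1 else 0)" for S
    by (rule annihilated_extend)
  then obtain u where u: "\<And>S. u S \<in> annihilated \<tau>"
    "\<And>S T. T \<in> set free_sets \<Longrightarrow> u S $ T = (if T = S then 1 else 0)" by metis
  have "lin l x = lin (\<Sum>S\<in>set free_sets. lin l (u S) *s axis S 1) x" if x: "x \<in> annihilated \<tau>" for x
  proof -
    define y where "y = (\<Sum>S\<in>set free_sets. x $ S *s u S)"
    have "y \<in> annihilated \<tau>"
      unfolding y_def by (intro vec.subspace_sum vec.subspace_scale annihilated_subspace u)
    then have "x - y \<in> annihilated \<tau>"
      by (rule vec.subspace_diff[OF annihilated_subspace x])
    moreover have "(x - y) $ T = 0" if "T \<in> set free_sets" for T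
      using that by (simp add: y_def u(2) if_distrib[of "\<lambda>t. _ * t"] cong: if_cong)
    ultimately have "x - y = 0" by (rule annihilated_determined)
    then have "lin l x = lin l y" by simp
    then have "lin l x = (\<Sum>S\<in>set free_sets. x $ S * lin l (u S))"
      by (simp only: y_def lin_sum_right lin_scale_right)
    then show ?thesis
      by (simp add: lin_sum_left lin_scale_left mult.commute)
  qed
  then show thesis
    by (intro that[of "\<lambda>S. lin l (u S)"]) (simp add: sec_eq_iff_annihilated)
qed

lemma section_comb_coord: "section_comb (\<lambda>k. coord (\<kappa> k)) c = sec (\<Sum>k\<in>UNIV. c $ k *s axis (\<kappa> k) 1)"
  unfolding coord_def by (rule section_comb_sec)

text \<open>A vector whose only nonzero free coordinate is that of \<open>\<kappa> j\<close> reads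
  off the coefficient at \<open>j\<close>. The index type stays open to serve both the full system
  and the line.\<close>

lemma inj_section_comb_coord:
  fixes \<kappa> :: "'k::finite \<Rightarrow> idx set"
  assumes \<kappa>: "inj \<kappa>" "range \<kappa> \<subseteq> set free_sets"
  shows "inj (section_comb (\<lambda>k. coord (\<kappa> k)))"
proof (rule injI)
  fix c d :: "complex ^ 'k"
  assume "section_comb (\<lambda>k. coord (\<kappa> k)) c = section_comb (\<lambda>k. coord (\<kappa> k)) d"
  then have eq: "(\<Sum>k\<in>UNIV. c $ k * x $ \<kappa> k) = (\<Sum>k\<in>UNIV. d $ k * x $ \<kappa> k)" if "x \<in> annihilated \<tau>" for x
    using that unfolding section_comb_coord sec_eq_iff_annihilated lin_sum_left lin_scale_left lin_axis_left
    by blast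
  have "c $ j = d $ j" for j
  proof -
    obtain x where x: "x \<in> annihilated \<tau>" "\<forall>S\<in>set free_sets. x $ S = (if S = \<kappa> j then 1 else 0)"
      using annihilated_extend[of \<tau> "\<lambda>S. if S = \<kappa> j then 1 else 0"] by blast
    have "\<kappa> k \<in> set free_sets" for k using \<kappa>(2) by blast
    then have "x $ \<kappa> k = (if k = j then 1 else 0)" for k
      using x(2) by (simp add: inj_eq[OF \<kappa>(1)])
    with eq[OF x(1)] show ?thesis by (simp add: if_distrib[of "\<lambda>t. _ * t"] cong: if_cong)
  qed
  then show "c = d" by (simp add: vec_eq_iff)
qed

lemma sum_reindex_coord:
  assumes "bij_betw \<kappa> UNIV A"
  shows "section_comb (\<lambda>k. coord (\<kappa> k)) (\<chi> k. c (\<kappa> k)) = sec (\<Sum>S\<in>A. c S *s axis S 1)"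
  unfolding section_comb_coord vec_lambda_beta
  using sum.reindex_bij_betw[OF assms, of "\<lambda>S. c S *s axis S 1"] by simp

text \<open>Linear coordinates on the space of sections; with fourteen free sets they identify the
  linear system with a projective space of dimension 13.\<close>

lemma bij_section_comb_coord:
  assumes \<kappa>: "bij_betw \<kappa> UNIV (set free_sets)"
  shows "bij_betw (section_comb (\<lambda>k. coord (\<kappa> k))) UNIV (sections V g)"
proof -
  have "inj (section_comb (\<lambda>k. coord (\<kappa> k)))"
    using \<kappa> by (intro inj_section_comb_coord) (auto simp: bij_betw_def)
  moreover have "range (section_comb (\<lambda>k. coord (\<kappa> k))) = sections V g"
  proof (rule equalityI)
    show "range (section_comb (\<lambda>k. coord (\<kappa> k))) \<subseteq> sections V g"
      unfolding sections_eq section_comb_coord by blast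
    show "sections V g \<subseteq> range (section_comb (\<lambda>k. coord (\<kappa> k)))"
    proof
      fix s assume "s \<in> sections V g"
      then obtain l where "s = sec l" unfolding sections_eq by blast
      with sec_free_coordinates[of l] obtain c where "s = sec (\<Sum>S\<in>set free_sets. c S *s axis S 1)" by metis
      then have "s = section_comb (\<lambda>k. coord (\<kappa> k)) (\<chi> k. c (\<kappa> k))"
        by (simp only: sum_reindex_coord[OF \<kappa>])
      then show "s \<in> range (section_comb (\<lambda>k. coord (\<kappa> k)))" by (rule range_eqI)
    qed
  qed
  ultimately show ?thesis by (simp add: bij_betw_def)
qed

text \<open>The form is nonzero on the span of the cone, so it cannot vanish on the whole
  cone.\<close>

lemma coord_nonzero:
  assumes "S \<in> set free_sets" shows "\<exists>x\<in>\<Union>V. lin (axis S 1) x \<noteq> 0"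
proof -
  obtain x where "x \<in> annihilated \<tau>" "x $ S = 1"
    using annihilated_extend[of \<tau> "\<lambda>_. 1"] assms by blast
  then have "sec (axis S 1) \<noteq> sec 0" by (simp add: sec_eq_iff_annihilated) (metis zero_neq_one)
  then show ?thesis by (simp add: sec_eq_iff)
qed

lemma weight_axis: "axis S 1 $ T \<noteq> (0 :: complex) \<Longrightarrow> weight T = weight S"
  by (auto simp: axis_def split: if_splits)

lemma weight_zero_sum:
  fixes c :: "complex ^ 'k::finite"
  assumes "\<And>k. weight (\<kappa> k) = 0" and "(\<Sum>k\<in>UNIV. c $ k *s axis (\<kappa> k) 1) $ T \<noteq> 0"
  shows "weight T = 0"
proof -
  from assms(2) obtain k where "(axis (\<kappa> k) 1 :: ext) $ T \<noteq> 0"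
    by (auto elim!: sum.not_neutral_contains_not_neutral)
  with assms(1) weight_axis show ?thesis by metis
qed

abbreviation "isolated \<equiv> {S \<in> set free_sets. weight S \<noteq> 0}"
abbreviation "neutral \<equiv> {S \<in> set free_sets. weight S = 0}"

lemma coord_divisors_distinct: "inj_on (\<lambda>S. divisor V (coord S)) isolated"
proof (rule inj_onI)
  fix S T assume S: "S \<in> isolated" and T: "T \<in> isolated" and eq: "divisor V (coord S) = divisor V (coord T)"
  show "S = T"
  proof (rule ccontr)
    assume "S \<noteq> T"
    with S T have "weight S \<noteq> weight T" using inj_on_weight by (meson inj_on_def)
    moreover obtain x where "x \<in> \<Union>V" "lin (axis S 1) x \<noteq> 0" using coord_nonzero S by blast
    ultimately have "divisor V (coord S) \<noteq> divisor V (coord T)"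
      unfolding coord_def using weight_axis different_weights_different_divisors by metis
    with eq show False by blast
  qed
qed

text \<open>Up to equality of sections, a form of one weight combines the free coordinates of that
  weight: a multiple of a single one for nonzero weight, and the pencil of \<open>neutral\<close>
  ones for weight zero.\<close>

lemma invariant_divisors:
  fixes \<kappa> :: "'k::finite \<Rightarrow> idx set"
  assumes \<kappa>: "bij_betw \<kappa> UNIV neutral"
  defines "P \<equiv> (\<lambda>S. divisor V (coord S)) ` isolated"
    and "L \<equiv> {divisor V (section_comb (\<lambda>k. coord (\<kappa> k)) c) |c. c \<noteq> 0}"
  shows "P \<inter> L = {}" and "{D \<in> linear_system V g. invariant_divisor V (torus V) D} = P \<union> L"
proof -
  have \<kappa>0: "weight (\<kappa> k) = 0" for k
    using \<kappa> by (auto simp: bij_betw_def)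
  have \<kappa>_inj: "inj (section_comb (\<lambda>k. coord (\<kappa> k)))"
    using \<kappa> by (intro inj_section_comb_coord) (auto simp: bij_betw_def)
  have comb0: "section_comb (\<lambda>k. coord (\<kappa> k)) 0 = sec 0"
    by (simp add: section_comb_coord)
  show "P \<inter> L = {}"
  proof -
    have "divisor V (coord S) \<noteq> divisor V (section_comb (\<lambda>k. coord (\<kappa> k)) c)" if S: "S \<in> isolated" for S c
    proof -
      obtain x where x: "x \<in> \<Union>V" "lin (axis S 1) x \<noteq> 0" using coord_nonzero S by blast
      have "divisor V (sec (axis S 1)) \<noteq> divisor V (sec (\<Sum>k\<in>UNIV. c $ k *s axis (\<kappa> k) 1))"
      proof (rule different_weights_different_divisors)
        show "weight S \<noteq> 0" using S by simp
      qed (fact x weight_axis weight_zero_sum[OF \<kappa>0])+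
      then show ?thesis unfolding section_comb_coord by (simp add: coord_def)
    qed
    then show ?thesis unfolding P_def L_def by blast
  qed
  show "{D \<in> linear_system V g. invariant_divisor V (torus V) D} = P \<union> L"
  proof (intro equalityI subsetI)
    fix D assume "D \<in> P \<union> L"
    then show "D \<in> {D \<in> linear_system V g. invariant_divisor V (torus V) D}"
    proof
      assume "D \<in> P"
      then obtain S where S: "S \<in> set free_sets" "D = divisor V (sec (axis S 1))"
        unfolding P_def coord_def by blast
      then show ?thesis
        using coord_nonzero weight_vector_invariant[OF weight_axis] unfolding linear_system_eq by blast
    next
      assume "D \<in> L"
      then obtain c where c: "c \<noteq> 0" "D = divisor V (section_comb (\<lambda>k. coord (\<kappa> k)) c)"
        unfolding L_def by blast
      let ?l = "\<Sum>k\<in>UNIV. c $ k *s axis (\<kappa> k) 1"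
      have "sec ?l \<noteq> sec 0"
        using c(1) inj_eq[OF \<kappa>_inj, of c 0] unfolding comb0 section_comb_coord by simp
      then have "\<exists>x\<in>\<Union>V. lin ?l x \<noteq> 0" by (simp add: sec_eq_iff)
      moreover have "invariant_divisor V (torus V) (divisor V (sec ?l))"
        by (rule weight_vector_invariant) (rule weight_zero_sum[OF \<kappa>0])
      ultimately show ?thesis
        unfolding c(2) section_comb_coord linear_system_eq by blast
    qed
  next
    fix D assume "D \<in> {D \<in> linear_system V g. invariant_divisor V (torus V) D}"
    then obtain l where l: "D = divisor V (sec l)" "\<exists>x\<in>\<Union>V. lin l x \<noteq> 0"
      and inv: "invariant_divisor V (torus V) D" unfolding linear_system_eq by blast
    from l(2) have nz: "sec l \<noteq> sec 0" by (simp add: sec_eq_iff)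
    obtain c where c: "sec l = sec (\<Sum>S\<in>set free_sets. c S *s axis S 1)"
      using sec_free_coordinates by blast
    \<comment> \<open>A representative of the same section supported on the free sets, so that its
      weight parts involve free coordinates only.\<close>
    define l' :: ext where "l' = (\<Sum>S\<in>set free_sets. c S *s axis S 1)"
    have "invariant_divisor V (torus V) (divisor V (sec l'))"
      using inv unfolding l(1) c l'_def .
    then obtain v where v: "sec l' = sec (weight_part v l')" by (rule invariant_imp_weight_vector)
    have "weight_part v l' = (\<Sum>S\<in>{S \<in> set free_sets. weight S = v}. c S *s axis S 1)"
      (is "_ = (\<Sum>S\<in>?A. _)")
    proof -
      have "weight_part v l' = (\<Sum>S\<in>set free_sets. if weight S = v then c S *s axis S 1 else 0)"
        unfolding l'_def weight_part_def vec_eq_iff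
        by (auto simp: axis_def intro!: sum.cong sum.neutral)
      then show ?thesis by (simp add: sum.inter_filter)
    qed
    with v c have sl: "sec l = sec (\<Sum>S\<in>?A. c S *s axis S 1)" by (simp add: l'_def)
    show "D \<in> P \<union> L"
    proof (cases "v = 0")
      case True
      let ?c = "\<chi> k. c (\<kappa> k)"
      have eq: "sec l = section_comb (\<lambda>k. coord (\<kappa> k)) ?c"
        using sl sum_reindex_coord[OF \<kappa>, of c] True by simp
      then have "?c \<noteq> 0" using nz comb0 by metis
      then have "D \<in> L" unfolding L_def l(1) eq by blast
      then show ?thesis ..
    next
      case False
      \<comment> \<open>An empty sum would be the zero section; as \<open>v\<close> is nonzero,
        \<open>?A\<close> then has exactly one element.\<close>
      have "?A \<noteq> {}" using sl nz by force
      then obtain S where S: "S \<in> ?A" by blast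
      have "?A = {S}" using S False inj_on_weight by (auto simp: inj_on_def)
      then have eq: "sec l = sec (c S *s axis S 1)" using sl by simp
      then have "c S \<noteq> 0" using nz by auto
      then have "D = divisor V (coord S)" unfolding l(1) eq coord_def by (rule divisor_scale)
      moreover have "S \<in> isolated" using S False by simp
      ultimately show ?thesis unfolding P_def by blast
    qed
  qed
qed

end

section \<open>Counting free sets and assembling the result\<close>

theorem proposition4p1:
  fixes V :: "idx set ppt set"
  assumes "V \<in> family_Va"
  shows "(\<exists>b :: 14 \<Rightarrow> idx set sect. bij_betw (section_comb b) UNIV (sections V anticanonical)) \<and>
    (\<exists>P L. card P = 12 \<and> line_in_system V anticanonical L \<and> P \<inter> L = {} \<and>
       {D \<in> linear_system V anticanonical. invariant_divisor V (torus V) D} = P \<union> L)"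
proof -
  from assms obtain \<tau> where V: "mukai_threefold V" "Cstar_iso_Aut0 V (torus V)"
    "anticanonically_embedded V (annihilated \<tau>)"
    unfolding family_Va_def by blast
  from V(3) obtain F where F: "vec.span (\<Union>V) = annihilated \<tau>" "\<forall>\<phi>\<in>charts V. lifts \<phi> (F \<phi>)"
    "sections V anticanonical =
      {(\<lambda>\<phi> z. if \<phi> \<in> charts V \<and> z \<in> UB then \<Sum>i\<in>UNIV. l $ i * F \<phi> z $ i else 0) |l. True}"
    unfolding anticanonically_embedded_def by blast
  \<comment> \<open>An element of the identity component is the endpoint at 1 of a path of
    automorphisms.\<close>
  have "torus V s \<in> Aut V" if "s \<noteq> 0" for s
  proof -
    have "torus V s \<in> Aut0 V"
      using V(2) that by (auto simp: Cstar_iso_Aut0_def bij_betw_def)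
    then obtain h :: "real \<Rightarrow> idx set ppt \<Rightarrow> idx set ppt" where
      "\<forall>r\<in>{0..1}. h r \<in> Aut V" "h 1 = torus V s"
      by (auto simp: Aut0_def)
    then show ?thesis by (metis atLeastAtMost_iff order_refl zero_le_one)
  qed
  then interpret Va_sections V anticanonical F \<tau>
    using V(1) F by unfold_locales (auto simp: mukai_threefold_def)
  have card_free: "card (set free_sets) = 14"
    using distinct_card[OF distinct_free_sets] by (simp add: free_sets_def)
  \<comment> \<open>The index -3 tells the two free sets of weight zero apart.\<close>
  have "idx (- 3) \<in> quad (- 3) (- 2) 2 3 - quad (- 2) (- 1) 1 2" by simp
  then have "quad (- 3) (- 2) 2 3 \<noteq> quad (- 2) (- 1) 1 2" by blast
  then have card_neutral: "card neutral = 2" by (simp add: weight_zero_free_sets)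
  have "isolated = set free_sets - neutral" by blast
  then have card_isolated: "card isolated = 12"
    using card_free card_neutral by (simp add: card_Diff_subset)
  obtain \<kappa> :: "14 \<Rightarrow> idx set" where \<kappa>: "bij_betw \<kappa> UNIV (set free_sets)"
    using finite_same_card_bij[of "UNIV :: 14 set" "set free_sets"] card_free by auto
  obtain \<nu> :: "2 \<Rightarrow> idx set" where \<nu>: "bij_betw \<nu> UNIV neutral"
    using finite_same_card_bij[of "UNIV :: 2 set" neutral] card_neutral by auto
  let ?P = "(\<lambda>S. divisor V (coord S)) ` isolated"
  let ?L = "{divisor V (section_comb (\<lambda>k. coord (\<nu> k)) c) |c. c \<noteq> 0}"
  have "card ?P = 12"
    using card_image[OF coord_divisors_distinct] card_isolated by simp
  moreover have "line_in_system V anticanonical ?L"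
    unfolding line_in_system_def
  proof (intro exI[of _ "\<lambda>k. coord (\<nu> k)"] conjI allI)
    show "coord (\<nu> k) \<in> sections V anticanonical" for k
      unfolding sections_eq coord_def by blast
    show "inj (section_comb (\<lambda>k. coord (\<nu> k)))"
      using \<nu> by (intro inj_section_comb_coord) (auto simp: bij_betw_def)
  qed simp
  ultimately show ?thesis
    using bij_section_comb_coord[OF \<kappa>] invariant_divisors[OF \<nu>] by blast
qed

end
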